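(* Let $\Omega\subset\mathbb{C}$ be a simply connected domain, $F$ holomorphic on $\Omega$ with $F\not\equiv0$, $K\subset\Omega$ compact and $\xi\in K$ such that $\Gamma_+(\xi)\subset K$ (resp. $\Gamma_-(\xi)\subset K$) for the system $\dot x=F(x)$ with real time. Then either $\Gamma(\xi)$ is a periodic orbit with exactly one equilibrium in its interior, and this equilibrium is a center, or the positive (resp. negative) limit set of $\Gamma(\xi)$ consists of exactly one equilibrium. Additionally, if $\Gamma(\xi)$ is periodic, then the interior of $\Gamma(\xi)$ with the center removed is filled entirely with periodic orbits, each of which has the center in its interior.
   Context: $\Phi(t,x_0)$ denotes the solution with $\Phi(0,x_0)=x_0$ on its maximal interval $I(x_0)$; $\Gamma(x_0)=\Phi(I(x_0),x_0)$, $\Gamma_+(x_0)=\Phi(I(x_0)\cap[0,\infty),x_0)$, $\Gamma_-(x_0)=\Phi(I(x_0)\cap(-\infty,0],x_0)$. The positive (negative) limit set $w_{+}(\Gamma(x_0))$ ($w_-(\Gamma(x_0))$) is the set of $v\in\mathbb{C}$ with $\Phi(t_k,x_0)\to v$ for some sequence $t_k\to+\infty$ ($-\infty$) in $I(x_0)$. The interior of a closed Jordan curve is its bounded complementary component. An equilibrium $a$ is a center if there is $\delta>0$ such that for every $y\in B_\delta(a)\setminus\{a\}$ the orbit $\Gamma(y)$ is a closed curve with $a$ in its interior. *)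

theory Defs
  imports "HOL-Complex_Analysis.Complex_Analysis"
begin

definition is_sol :: "(complex \<Rightarrow> complex) \<Rightarrow> complex set \<Rightarrow> complex \<Rightarrow> real set \<Rightarrow> (real \<Rightarrow> complex) \<Rightarrow> bool" where
  "is_sol F \<Omega> x0 J \<phi> \<longleftrightarrow> is_interval J \<and> open J \<and> 0 \<in> J \<and> \<phi> 0 = x0 \<and>
     (\<forall>t\<in>J. \<phi> t \<in> \<Omega> \<and> (\<phi> has_vector_derivative F (\<phi> t)) (at t))"

definition ex_ivl :: "(complex \<Rightarrow> complex) \<Rightarrow> complex set \<Rightarrow> complex \<Rightarrow> real set" where
  "ex_ivl F \<Omega> x0 = \<Union>{J. \<exists>\<phi>. is_sol F \<Omega> x0 J \<phi>}"

text \<open>The solution Phi(t, x0) (well defined on ex_ivl by uniqueness).\<close>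
definition flow :: "(complex \<Rightarrow> complex) \<Rightarrow> complex set \<Rightarrow> real \<Rightarrow> complex \<Rightarrow> complex" where
  "flow F \<Omega> t x0 = (SOME v. \<exists>J \<phi>. is_sol F \<Omega> x0 J \<phi> \<and> t \<in> J \<and> \<phi> t = v)"

definition orbit :: "(complex \<Rightarrow> complex) \<Rightarrow> complex set \<Rightarrow> complex \<Rightarrow> complex set" where
  "orbit F \<Omega> x0 = (\<lambda>t. flow F \<Omega> t x0) ` ex_ivl F \<Omega> x0"

definition pos_orbit :: "(complex \<Rightarrow> complex) \<Rightarrow> complex set \<Rightarrow> complex \<Rightarrow> complex set" where
  "pos_orbit F \<Omega> x0 = (\<lambda>t. flow F \<Omega> t x0) ` (ex_ivl F \<Omega> x0 \<inter> {0..})"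

definition neg_orbit :: "(complex \<Rightarrow> complex) \<Rightarrow> complex set \<Rightarrow> complex \<Rightarrow> complex set" where
  "neg_orbit F \<Omega> x0 = (\<lambda>t. flow F \<Omega> t x0) ` (ex_ivl F \<Omega> x0 \<inter> {..0})"

definition pos_limit_set :: "(complex \<Rightarrow> complex) \<Rightarrow> complex set \<Rightarrow> complex \<Rightarrow> complex set" where
  "pos_limit_set F \<Omega> x0 = {v. \<exists>tk. (\<forall>k. tk k \<in> ex_ivl F \<Omega> x0) \<and> filterlim tk at_top sequentially \<and>
      (\<lambda>k. flow F \<Omega> (tk k) x0) \<longlonglongrightarrow> v}"

definition neg_limit_set :: "(complex \<Rightarrow> complex) \<Rightarrow> complex set \<Rightarrow> complex \<Rightarrow> complex set" where
  "neg_limit_set F \<Omega> x0 = {v. \<exists>tk. (\<forall>k. tk k \<in> ex_ivl F \<Omega> x0) \<and> filterlim tk at_bot sequentially \<and>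
      (\<lambda>k. flow F \<Omega> (tk k) x0) \<longlonglongrightarrow> v}"

definition equilibrium :: "(complex \<Rightarrow> complex) \<Rightarrow> complex set \<Rightarrow> complex \<Rightarrow> bool" where
  "equilibrium F \<Omega> a \<longleftrightarrow> a \<in> \<Omega> \<and> F a = 0"

definition closed_orbit :: "(complex \<Rightarrow> complex) \<Rightarrow> complex set \<Rightarrow> complex \<Rightarrow> bool" where
  "closed_orbit F \<Omega> y \<longleftrightarrow> (\<exists>g. simple_path g \<and> pathfinish g = pathstart g \<and> path_image g = orbit F \<Omega> y)"

definition periodic_orbit :: "(complex \<Rightarrow> complex) \<Rightarrow> complex set \<Rightarrow> complex \<Rightarrow> bool" where
  "periodic_orbit F \<Omega> y \<longleftrightarrow> y \<in> \<Omega> \<and> F y \<noteq> 0 \<and>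
     (\<exists>T>0. T \<in> ex_ivl F \<Omega> y \<and> flow F \<Omega> T y = y) \<and> closed_orbit F \<Omega> y"

definition center :: "(complex \<Rightarrow> complex) \<Rightarrow> complex set \<Rightarrow> complex \<Rightarrow> bool" where
  "center F \<Omega> a \<longleftrightarrow> equilibrium F \<Omega> a \<and>
     (\<exists>\<delta>>0. \<forall>y\<in>ball a \<delta> - {a}. closed_orbit F \<Omega> y \<and> a \<in> inside (orbit F \<Omega> y))"

end

theory Submission
  imports Defs
begin

text \<open>
  The proof works in complex time. Along a solution staying in a compact set the complex solution
  has a uniform radius of existence, so it extends to a bounded holomorphic \<open>\<psi>\<close> on a half strip
  around the positive real axis. If the orbit has a regular limit point \<open>p\<close>, then \<open>\<psi>\<close> takes the value
  \<open>p\<close> at two points near the axis, and by uniqueness their difference is a period of \<open>\<psi>\<close>. A real period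
  makes the orbit periodic; a non-real one makes \<open>\<psi>\<close> a bounded holomorphic function of
  \<open>exp (2 \<pi> \<i> s / d)\<close> near a removable singularity, so the orbit would converge, which it can do only
  to an equilibrium. If all limit points are equilibria, isolation of zeros gives convergence.

  Inside a periodic orbit of period \<open>T\<close>, the time-\<open>T\<close> map is holomorphic and is the identity near
  the orbit, hence everywhere, so all regular points are periodic. Every periodic orbit encloses
  an equilibrium since the integral of \<open>1 / F\<close> along it is \<open>T \<noteq> 0\<close>. It encloses only one, since
  by the Schwarz lemma a holomorphic self map of a disc with two fixed points is the identity.
\<close>

subsection \<open>Uniqueness of solutions in real and complex time\<close>

text \<open>Complex time takes over the role of a transversal. Two late visits near \<open>p\<close>
  at real times are corrected by small complex times so as to hit \<open>p\<close> exactly, and the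
  difference of the corrected times is a genuine period, though perhaps not a real one. The constant
  width of the strip leaves room for this correction at arbitrarily late times; its boundedness
  makes the singularity removable. Both come from the compactness of \<open>K\<close>.

  Inside a periodic orbit the obstacle is that complex time is a local coordinate only at regular
  points, so the time-\<open>t\<close> map is at first known to be holomorphic only there; at
  equilibria it has to be recovered from continuity. Moreover the orbit is merely the frontier of
  its interior, so the identity is obtained on a neighbourhood of an orbit point and then carried
  into the interior. Simple connectedness of \<Omega> places the interior inside \<Omega> and
  annihilates winding numbers about points outside \<Omega>; simple connectedness of the interior
  itself is what makes it a disc for the Schwarz lemma.\<close>

locale holo_field =
  fixes F :: "complex \<Rightarrow> complex" and \<Omega> :: "complex set"
  assumes open_dom: "open \<Omega>" and holo: "F holomorphic_on \<Omega>"
begin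

text \<open>Solutions in complex time. Initial value and shape of \<open>A\<close> are left open, so
  that restrictions and translates are again of this form.\<close>

definition csol :: "complex set \<Rightarrow> (complex \<Rightarrow> complex) \<Rightarrow> bool" where
  "csol A f \<longleftrightarrow> (\<forall>s\<in>A. f s \<in> \<Omega> \<and> (f has_field_derivative F (f s)) (at s))"

text \<open>Two factors matter: the direction of a segment in complex time, along which a complex
  solution solves a rescaled real equation, and -1 for time reversal.\<close>

lemma holo_field_mult: "holo_field (\<lambda>z. u * F z) \<Omega>"
  by unfold_locales (use open_dom holo in \<open>auto intro!: holomorphic_intros\<close>)

lemma field_continuous: "continuous_on \<Omega> F"
  using holo holomorphic_on_imp_continuous_on by blast

lemma lipschitz_near:
  assumes "x \<in> \<Omega>"
  obtains \<rho> L where "0 < \<rho>" "0 < L" "cball x \<rho> \<subseteq> \<Omega>"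
    "\<And>y z. y \<in> cball x \<rho> \<Longrightarrow> z \<in> cball x \<rho> \<Longrightarrow> norm (F y - F z) \<le> L * norm (y - z)"
proof -
  obtain \<rho> where \<rho>: "0 < \<rho>" "cball x \<rho> \<subseteq> \<Omega>"
    using open_dom assms open_contains_cball by blast
  have "compact ((deriv F) ` cball x \<rho>)"
    using holomorphic_deriv[OF holo open_dom] \<rho>
    by (intro compact_continuous_image compact_cball)
       (meson continuous_on_subset holomorphic_on_imp_continuous_on)
  then obtain L where L: "0 < L" "\<And>z. z \<in> cball x \<rho> \<Longrightarrow> norm (deriv F z) \<le> L"
    by (metis bounded_pos compact_imp_bounded imageI)
  show thesis
  proof (rule that[OF \<rho>(1) L(1) \<rho>(2)])
    fix y z assume "y \<in> cball x \<rho>" "z \<in> cball x \<rho>"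
    then show "norm (F y - F z) \<le> L * norm (y - z)"
      using holo open_dom \<rho> L
      by (intro field_differentiable_bound[of "cball x \<rho>" F "deriv F"])
         (auto intro: has_field_derivative_at_within holomorphic_derivI)
  qed
qed

text \<open>A maximum argument in place of a Gronwall estimate: on an interval of radius
  \<open>h\<close> with \<open>L * h \<le> 1 / 2\<close>, the largest value of
  \<open>norm (f t - g t)\<close> is at most half of itself, hence 0.\<close>

lemma sol_unique_local:
  assumes A: "open A" "t0 \<in> A"
    and f: "\<And>t. t \<in> A \<Longrightarrow> f t \<in> \<Omega> \<and> (f has_vector_derivative F (f t)) (at t)"
    and g: "\<And>t. t \<in> A \<Longrightarrow> g t \<in> \<Omega> \<and> (g has_vector_derivative F (g t)) (at t)"
    and eq: "f t0 = g t0"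
  shows "\<exists>h>0. \<forall>t\<in>ball t0 h. f t = (g t :: complex)"
proof -
  obtain \<rho> L where \<rho>: "0 < \<rho>" "0 < L" "cball (f t0) \<rho> \<subseteq> \<Omega>"
    and L: "\<And>y z. y \<in> cball (f t0) \<rho> \<Longrightarrow> z \<in> cball (f t0) \<rho> \<Longrightarrow> norm (F y - F z) \<le> L * norm (y - z)"
    using lipschitz_near f A by metis
  have cf: "isCont f t0" and cg: "isCont g t0"
    using f g A has_vector_derivative_continuous by blast+
  obtain d1 where d1: "0 < d1" "\<And>t. dist t t0 < d1 \<Longrightarrow> dist (f t) (f t0) < \<rho>"
    using cf \<rho>(1) unfolding continuous_at by (metis (no_types) tendsto_iff LIM_def dist_self cf isContD)
  obtain d2 where d2: "0 < d2" "\<And>t. dist t t0 < d2 \<Longrightarrow> dist (g t) (g t0) < \<rho>"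
    using cg \<rho>(1) by (metis LIM_def dist_self isContD)
  obtain d3 where d3: "0 < d3" "ball t0 d3 \<subseteq> A"
    using A open_contains_ball by blast
  \<comment> \<open>Halving \<open>m0\<close> makes the bounds by \<open>d1\<close>,
    \<open>d2\<close>, \<open>d3\<close> strict, as the closed ball of radius \<open>h\<close> is
    used below; \<open>1 / (2 * L)\<close> yields the factor one half.\<close>
  define m0 where "m0 = min (min d1 d2) (min d3 (1 / (2 * L)))"
  define h where "h = m0 / 2"
  have m0: "0 < m0" "m0 \<le> d1" "m0 \<le> d2" "m0 \<le> d3" "m0 \<le> 1 / (2 * L)"
    unfolding m0_def using d1 d2 d3 \<rho> by auto
  then have h: "0 < h" "h < d1" "h < d2" "h < d3" "h \<le> 1 / (2 * L)"
    unfolding h_def by linarith+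
  then have hL: "L * h \<le> 1 / 2" using \<rho> by (simp add: field_simps)
  have inA: "cball t0 h \<subseteq> A" using h d3 by auto
  define d where "d = (\<lambda>t. f t - g t)"
  have dd: "(d has_vector_derivative (F (f t) - F (g t))) (at t)" if "t \<in> cball t0 h" for t
    unfolding d_def using f g that inA by (intro derivative_intros) auto
  have "continuous_on (cball t0 h) (\<lambda>t. norm (d t))"
    by (intro continuous_intros continuous_at_imp_continuous_on)
       (use dd has_vector_derivative_continuous in blast)
  then obtain m where m: "m \<in> cball t0 h" "\<And>t. t \<in> cball t0 h \<Longrightarrow> norm (d t) \<le> norm (d m)"
    using continuous_attains_sup[of "cball t0 h" "\<lambda>t. norm (d t)"] h by auto
  have "norm (d m - d t0) \<le> (L * norm (d m)) * norm (m - t0)"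
  proof (rule differentiable_bound[of "cball t0 h" d "\<lambda>t l. l *\<^sub>R (F (f t) - F (g t))"])
    fix t assume t: "t \<in> cball t0 h"
    show "(d has_derivative (\<lambda>l. l *\<^sub>R (F (f t) - F (g t)))) (at t within cball t0 h)"
      using dd[OF t] has_vector_derivative_at_within has_vector_derivative_def by blast
    have "norm (F (f t) - F (g t)) \<le> L * norm (f t - g t)"
      using t h d1(2)[of t] d2(2)[of t] eq by (intro L) (auto simp: dist_commute less_imp_le)
    also have "\<dots> \<le> L * norm (d m)"
      using m(2)[OF t] \<rho> unfolding d_def by simp
    finally show "onorm (\<lambda>l. l *\<^sub>R (F (f t) - F (g t))) \<le> L * norm (d m)"
      by (simp add: onorm_scaleR_left[OF bounded_linear_ident] onorm_id)
  qed (use m h in auto)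
  also have "\<dots> \<le> (L * norm (d m)) * h"
    using m \<rho> by (intro mult_left_mono) (auto simp: dist_norm norm_minus_commute)
  also have "\<dots> = (L * h) * norm (d m)" by simp
  also have "\<dots> \<le> 1 / 2 * norm (d m)" using hL by (intro mult_right_mono) auto
  finally have "norm (d m) = 0" using eq unfolding d_def by simp
  then show ?thesis using m(2) h(1) unfolding d_def by (intro exI[of _ h]) force
qed

text \<open>The set where the two solutions agree is closed by continuity and open by local
  uniqueness, so connectedness makes it everything.\<close>

lemma sol_unique_on:
  assumes A: "open A" "connected A" "t0 \<in> A"
    and f: "\<And>t. t \<in> A \<Longrightarrow> f t \<in> \<Omega> \<and> (f has_vector_derivative F (f t)) (at t)"
    and g: "\<And>t. t \<in> A \<Longrightarrow> g t \<in> \<Omega> \<and> (g has_vector_derivative F (g t)) (at t)"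
    and eq: "f t0 = g t0" and t: "t \<in> A"
  shows "f t = (g t :: complex)"
proof -
  have cont: "continuous_on A f" "continuous_on A g"
    using f g by (meson continuous_at_imp_continuous_on has_vector_derivative_continuous)+
  let ?T = "{t \<in> A. f t - g t = 0}"
  have "closedin (top_of_set A) ?T"
    by (intro continuous_closedin_preimage_constant continuous_intros cont)
  moreover have "open ?T"
    unfolding open_contains_ball
  proof
    fix s assume s: "s \<in> ?T"
    obtain h where "h > 0" "\<forall>t\<in>ball s h. f t = g t"
      using sol_unique_local[OF A(1) _ f g, of s] s by auto
    moreover obtain e where "e > 0" "ball s e \<subseteq> A"
      using A(1) s open_contains_ball by blast
    ultimately show "\<exists>e>0. ball s e \<subseteq> ?T"
      by (intro exI[of _ "min h e"]) auto
  qed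
  then have "openin (top_of_set A) ?T"
    by (metis (no_types, lifting) mem_Collect_eq open_subset subsetI)
  ultimately have "?T = {} \<or> ?T = A"
    using A(2) connected_clopen by blast
  then show ?thesis using eq A(3) t by auto
qed

lemma sol_unique:
  assumes "is_sol F \<Omega> x J f" "is_sol F \<Omega> x J' g" "t \<in> J" "t \<in> J'"
  shows "f t = g t"
proof (rule sol_unique_on[of "J \<inter> J'" 0])
  show "connected (J \<inter> J')"
    using assms unfolding is_sol_def by (simp add: is_interval_Int flip: is_interval_connected_1)
qed (use assms in \<open>auto simp: is_sol_def\<close>)

lemma csol_holomorphic: "csol A f \<Longrightarrow> f holomorphic_on A"
  unfolding csol_def holomorphic_on_def
  by (meson field_differentiable_at_within field_differentiable_def)

lemma csol_subset: "csol A f \<Longrightarrow> B \<subseteq> A \<Longrightarrow> csol B f"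
  unfolding csol_def by blast

lemma csol_shift: "csol A f \<Longrightarrow> (\<And>s. s \<in> B \<Longrightarrow> s + d \<in> A) \<Longrightarrow> csol B (\<lambda>s. f (s + d))"
  unfolding csol_def by (auto simp: DERIV_shift[of f, symmetric])

text \<open>Along the segment from \<open>c\<close> to \<open>s\<close>, which convexity keeps in
  \<open>A\<close>, both solutions become real-time solutions of the field multiplied by
  \<open>s - c\<close>; real uniqueness then applies between the parameters 0 and 1.\<close>

lemma csol_unique:
  assumes A: "open A" "convex A" and f: "csol A f" and g: "csol A g"
    and c: "c \<in> A" "f c = g c" and s: "s \<in> A"
  shows "f s = g s"
proof -
  interpret U: holo_field "\<lambda>z. (s - c) * F z" \<Omega> by (rule holo_field_mult)
  define h where "h = (\<lambda>l::real. c + of_real l * (s - c))"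
  have h: "(h has_vector_derivative (s - c)) (at l)" for l
    unfolding h_def by (auto intro!: derivative_eq_intros)
  have J: "open (h -` A)" "connected (h -` A)"
  proof -
    show "open (h -` A)" unfolding h_def by (intro open_vimage A continuous_intros)
    have "convex (h -` A)"
    proof (rule convexI)
      fix l m u v :: real assume *: "l \<in> h -` A" "m \<in> h -` A" "0 \<le> u" "0 \<le> v" "u + v = 1"
      have "h (u *\<^sub>R l + v *\<^sub>R m) = u *\<^sub>R h l + v *\<^sub>R h m + (1 - of_real (u + v)) * c"
        unfolding h_def by (simp add: algebra_simps scaleR_conv_of_real)
      also have "\<dots> = u *\<^sub>R h l + v *\<^sub>R h m" using * by simp
      finally show "u *\<^sub>R l + v *\<^sub>R m \<in> h -` A"
        using * A(2) by (auto simp: convex_def)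
    qed
    then show "connected (h -` A)" by (rule convex_connected)
  qed
  have fh: "f' (h l) \<in> \<Omega> \<and> ((\<lambda>l. f' (h l)) has_vector_derivative (s - c) * F (f' (h l))) (at l)"
    if "csol A f'" "l \<in> h -` A" for f' l
    using that field_vector_diff_chain_at[OF h, of f' "F (f' (h l))" l] unfolding csol_def o_def by auto
  have "f (h 1) = g (h 1)"
    by (rule U.sol_unique_on[OF J, of 0 "\<lambda>l. f (h l)" "\<lambda>l. g (h l)"])
       (use fh f g c s in \<open>auto simp: h_def\<close>)
  then show ?thesis by (simp add: h_def)
qed

lemma csol_sol:
  assumes "open A" "convex A" "csol A f" "s \<in> A"
  shows "is_sol F \<Omega> (f s) {l. s + of_real l \<in> A} (\<lambda>l. f (s + of_real l))"
proof -
  have eq: "{l. s + of_real l \<in> A} = (\<lambda>l. s + of_real l) -` A" by auto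
  have "convex {l::real. s + of_real l \<in> A}"
  proof (rule convexI)
    fix l m u v :: real
    assume *: "l \<in> {l. s + of_real l \<in> A}" "m \<in> {l. s + of_real l \<in> A}" "0 \<le> u" "0 \<le> v" "u + v = 1"
    have "s + of_real (u *\<^sub>R l + v *\<^sub>R m)
        = u *\<^sub>R (s + of_real l) + v *\<^sub>R (s + of_real m) + (1 - of_real (u + v)) * s"
      by (simp add: algebra_simps scaleR_conv_of_real)
    also have "\<dots> = u *\<^sub>R (s + of_real l) + v *\<^sub>R (s + of_real m)" using * by simp
    finally show "u *\<^sub>R l + v *\<^sub>R m \<in> {l. s + of_real l \<in> A}"
      using * assms(2) by (auto simp: convex_def)
  qed
  then have "is_interval {l::real. s + of_real l \<in> A}"
    using convex_connected is_interval_connected_1 by blast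
  moreover have "open {l::real. s + of_real l \<in> A}"
    unfolding eq by (intro open_vimage assms continuous_intros)
  moreover have "((\<lambda>l. f (s + of_real l)) has_vector_derivative F (f (s + of_real l))) (at l)"
    if "s + of_real l \<in> A" for l :: real
  proof -
    have "((\<lambda>l::real. s + of_real l) has_vector_derivative 1) (at l)"
      by (auto intro!: derivative_eq_intros)
    from field_vector_diff_chain_at[OF this, of f] show ?thesis
      using assms(3) that unfolding csol_def o_def by auto
  qed
  ultimately show ?thesis using assms(3,4) unfolding is_sol_def csol_def by auto
qed

subsection \<open>Local existence and the maximal flow\<close>

text \<open>Picard iteration on a disc of complex time. The radius \<open>r\<close> and the bound
  \<open>B\<close> depend on \<open>K\<close> only: \<open>r\<close> becomes the half width of the
  strip on which a bounded orbit extends, \<open>B\<close> bounds the extension.\<close>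

lemma picard:
  assumes K: "compact K" "K \<subseteq> \<Omega>"
  shows "\<exists>r>0. \<exists>B. bounded B \<and> (\<forall>x\<in>K. \<exists>f. csol (ball 0 r) f \<and> f 0 = x \<and> f ` ball 0 r \<subseteq> B)"
proof -
  obtain \<delta> where \<delta>: "0 < \<delta>" "(\<Union>x\<in>K. cball x \<delta>) \<subseteq> \<Omega>"
    using compact_subset_open_imp_cball_epsilon_subset[OF K(1) open_dom K(2)] by blast
  define K' where "K' = (\<Union>x\<in>K. cball x \<delta>)"
  have K': "compact K'" "K' \<subseteq> \<Omega>"
    unfolding K'_def using compact_minkowski_sum_cball[OF K(1)] \<delta> by auto
  have "compact (F ` K')" "compact (deriv F ` K')"
    using holomorphic_deriv[OF holo open_dom] K' field_continuous
    by (intro compact_continuous_image; meson continuous_on_subset holomorphic_on_imp_continuous_on)+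
  then obtain M L where M: "0 < M" "\<And>z. z \<in> K' \<Longrightarrow> norm (F z) \<le> M"
    and L: "0 < L" "\<And>z. z \<in> K' \<Longrightarrow> norm (deriv F z) \<le> L"
    by (metis bounded_pos compact_imp_bounded imageI)
  \<comment> \<open>\<open>\<delta> / M\<close> keeps every iterate within distance \<delta> of
    \<open>x\<close>; \<open>1 / (2 * L)\<close> makes each iteration at least halve the distance
    between successive iterates.\<close>
  define r where "r = min (\<delta> / M) (1 / (2 * L))"
  have r: "0 < r" "r \<le> \<delta> / M" "r \<le> 1 / (2 * L)" unfolding r_def using \<delta> M L by auto
  then have rM: "M * r \<le> \<delta>" and rL: "L * r \<le> 1 / 2" using M L by (auto simp: field_simps)
  have "\<exists>f. csol (ball 0 r) f \<and> f 0 = x \<and> f ` ball 0 r \<subseteq> K'" if x: "x \<in> K" for x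
  proof -
    let ?D = "ball (0::complex) r" and ?C = "cball x \<delta>"
    have C: "?C \<subseteq> K'" "?C \<subseteq> \<Omega>" using x K' unfolding K'_def by auto
    define good where "good = (\<lambda>f. f holomorphic_on ?D \<and> f 0 = x \<and> f ` ?D \<subseteq> ?C)"
    \<comment> \<open>One Picard step: a primitive of \<open>F \<circ> f\<close> exists because the
      disc is convex, and normalising it at 0 restores the initial value.\<close>
    have "\<exists>g. good g \<and> (\<forall>s\<in>?D. (g has_field_derivative F (f s)) (at s))" if "good f" for f
    proof -
      have "(F \<circ> f) holomorphic_on ?D"
        using that C(2) unfolding good_def
        by (intro holomorphic_on_compose_gen[OF _ holo]) blast+
      then obtain g where g: "\<And>s. s \<in> ?D \<Longrightarrow> (g has_field_derivative F (f s)) (at s)"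
        using holomorphic_convex_primitive'[of ?D "F \<circ> f"] by (auto simp: at_within_open[of _ ?D])
      let ?g = "\<lambda>s. g s - g 0 + x"
      have g': "(?g has_field_derivative F (f s)) (at s)" if "s \<in> ?D" for s
        using g[OF that] by (auto intro!: derivative_eq_intros)
      have "?g s \<in> ?C" if s: "s \<in> ?D" for s
      proof -
        have "norm (?g s - ?g 0) \<le> M * norm (s - 0)"
        proof (rule field_differentiable_bound[of ?D ?g "\<lambda>s. F (f s)"])
          fix u assume u: "u \<in> ?D"
          show "(?g has_field_derivative F (f u)) (at u within ?D)"
            using g'[OF u] by (rule has_field_derivative_at_within)
          have "f u \<in> K'" using u C(1) \<open>good f\<close> unfolding good_def by blast
          then show "norm (F (f u)) \<le> M" by (rule M(2))
        qed (use s r(1) in auto)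
        also have "\<dots> \<le> M * r" using s M by (intro mult_left_mono) auto
        finally show ?thesis using rM by (simp add: dist_norm norm_minus_commute)
      qed
      moreover have "?g holomorphic_on ?D"
        using g' by (meson field_differentiable_at_within field_differentiable_def holomorphic_on_def)
      ultimately show ?thesis
        unfolding good_def using g' by (intro exI[of _ ?g]) auto
    qed
    then obtain G where
      G: "\<And>f. good f \<Longrightarrow> good (G f) \<and> (\<forall>s\<in>?D. (G f has_field_derivative F (f s)) (at s))"
      by metis
    define f where "f = (\<lambda>n. (G ^^ n) (\<lambda>_. x))"
    have f0: "f 0 = (\<lambda>_. x)" and fS: "f (Suc n) = G (f n)" for n unfolding f_def by auto
    have fg: "good (f n)" for n
    proof (induction n)
      case 0
      have "(\<lambda>_. x) ` ?D \<subseteq> ?C" using \<delta>(1) by auto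
      then show ?case unfolding good_def f0 by simp
    next
      case (Suc n) then show ?case unfolding fS using G by blast
    qed
    have fd: "(f (Suc n) has_field_derivative F (f n s)) (at s)" if "s \<in> ?D" for n s
      using G[OF fg[of n]] that unfolding fS by blast
    have inC: "f n s \<in> ?C" if "s \<in> ?D" for n s
      using fg[of n] that unfolding good_def by blast
    have Lip: "norm (F y - F z) \<le> L * norm (y - z)" if "y \<in> ?C" "z \<in> ?C" for y z
    proof (rule field_differentiable_bound[of ?C F "deriv F"])
      fix z assume z: "z \<in> ?C"
      show "(F has_field_derivative deriv F z) (at z within ?C)"
        using holomorphic_derivI[OF holo open_dom] C(2) z has_field_derivative_at_within by blast
      show "norm (deriv F z) \<le> L" using L(2) C(1) z by blast
    qed (use that in \<open>simp_all only: convex_cball\<close>)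
    have step: "norm (f (Suc n) s - f n s) \<le> \<delta> * (1 / 2) ^ n" if s: "s \<in> ?D" for n s
      using s
    proof (induction n arbitrary: s)
      case 0
      then show ?case using inC[of s "Suc 0"] by (simp add: f0 dist_norm norm_minus_commute)
    next
      case (Suc n)
      let ?d = "\<lambda>s. f (Suc (Suc n)) s - f (Suc n) s"
      define d where "d = ?d"
      define C where "C = L * (\<delta> * (1 / 2) ^ n)"
      have "norm (d s - d 0) \<le> C * norm (s - 0)"
      proof (rule field_differentiable_bound[of ?D d "\<lambda>s. F (f (Suc n) s) - F (f n s)"])
        fix u assume u: "u \<in> ?D"
        have "(d has_field_derivative F (f (Suc n) u) - F (f n u)) (at u)"
          unfolding d_def by (intro DERIV_diff fd u)
        then show "(d has_field_derivative F (f (Suc n) u) - F (f n u)) (at u within ?D)"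
          by (rule has_field_derivative_at_within)
        have "norm (F (f (Suc n) u) - F (f n u)) \<le> L * norm (f (Suc n) u - f n u)"
          by (rule Lip[OF inC[OF u] inC[OF u]])
        also have "\<dots> \<le> C"
          unfolding C_def using Suc.IH[OF u] L(1) by (intro mult_left_mono) simp_all
        finally show "norm (F (f (Suc n) u) - F (f n u)) \<le> C" .
      qed (use r(1) Suc.prems in \<open>simp_all\<close>)
      also have "\<dots> \<le> C * r"
        unfolding C_def using Suc.prems L(1) \<delta>(1) by (intro mult_left_mono) simp_all
      also have "\<dots> = (L * r) * (\<delta> * (1 / 2) ^ n)" unfolding C_def by simp
      also have "\<dots> \<le> 1 / 2 * (\<delta> * (1 / 2) ^ n)"
        using rL \<delta>(1) by (intro mult_right_mono) simp_all
      moreover have "d 0 = 0" using fg[of "Suc n"] fg[of "Suc (Suc n)"] unfolding d_def good_def by simp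
      ultimately show ?case unfolding d_def by simp
    qed
    \<comment> \<open>The iterates are the partial sums of a telescoping series dominated by a
      geometric one.\<close>
    have "uniformly_convergent_on ?D (\<lambda>n s. \<Sum>i<n. f (Suc i) s - f i s)"
      by (rule Weierstrass_m_test'[of _ _ "\<lambda>n. \<delta> * (1 / 2) ^ n"])
         (use step in \<open>auto intro!: summable_mult summable_geometric\<close>)
    then obtain h where h: "uniform_limit ?D (\<lambda>n s. \<Sum>i<n. f (Suc i) s - f i s) h sequentially"
      unfolding uniformly_convergent_on_def by blast
    define g where "g = (\<lambda>s. h s + x)"
    have "uniform_limit ?D (\<lambda>n s. (\<Sum>i<n. f (Suc i) s - f i s) + x) g sequentially"
      unfolding g_def using h by (intro uniform_limit_add uniform_limit_const)
    moreover have "(\<lambda>n s. (\<Sum>i<n. f (Suc i) s - f i s) + x) = f"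
    proof (intro ext)
      fix n s
      show "(\<Sum>i<n. f (Suc i) s - f i s) + x = f n s"
        using sum_lessThan_telescope[of "\<lambda>i. f i s" n] f0 by simp
    qed
    ultimately have ul: "uniform_limit ?D f g sequentially" by (simp only:)
    have lim: "(\<lambda>n. f n s) \<longlonglongrightarrow> g s" if "s \<in> ?D" for s
      by (rule tendsto_uniform_limitI[OF ul that])
    have gC: "g s \<in> ?C" if "s \<in> ?D" for s
      by (rule Lim_in_closed_set[OF closed_cball _ _ lim[OF that]]) (use inC[OF that] in auto)
    \<comment> \<open>The index is shifted because the derivative of \<open>f (Suc n)\<close> is
      \<open>F\<close> along \<open>f n\<close>; locally uniform limits commute with complex
      differentiation.\<close>
    have "\<exists>g'. \<forall>s\<in>?D. (g has_field_derivative g' s) (at s) \<and> (\<lambda>n. F (f n s)) \<longlonglongrightarrow> g' s"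
    proof (rule has_complex_derivative_uniform_sequence[of ?D "\<lambda>n. f (Suc n)"])
      fix s assume s: "s \<in> ?D"
      then obtain d where "d > 0" "cball s d \<subseteq> ?D"
        using open_contains_cball open_ball by blast
      moreover have "uniform_limit ?D (\<lambda>n. f (Suc n)) g sequentially"
        using ul filterlim_compose[OF _ filterlim_Suc] by blast
      ultimately show "\<exists>d>0. cball s d \<subseteq> ?D \<and> uniform_limit (cball s d) (\<lambda>n. f (Suc n)) g sequentially"
        using uniform_limit_on_subset by blast
    qed (use fd in auto)
    then obtain g' where g': "\<And>s. s \<in> ?D \<Longrightarrow> (g has_field_derivative g' s) (at s)"
      "\<And>s. s \<in> ?D \<Longrightarrow> (\<lambda>n. F (f n s)) \<longlonglongrightarrow> g' s" by blast
    have "g' s = F (g s)" if s: "s \<in> ?D" for s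
    proof -
      have "isCont F (g s)"
        using gC[OF s] C field_continuous open_dom continuous_on_eq_continuous_at by blast
      then have "(\<lambda>n. F (f n s)) \<longlonglongrightarrow> F (g s)"
        using lim[OF s] isCont_tendsto_compose by blast
      then show ?thesis using g'(2)[OF s] LIMSEQ_unique by blast
    qed
    moreover have "g 0 = x"
      using lim[of 0] r fg LIMSEQ_unique[of "\<lambda>_. x"] unfolding good_def by auto
    ultimately show ?thesis using g' gC C unfolding csol_def by (intro exI[of _ g]) auto
  qed
  then show ?thesis using r(1) compact_imp_bounded[OF K'(1)] by blast
qed

lemma sol_shift:
  assumes "is_sol F \<Omega> x J f" "s \<in> J"
  shows "is_sol F \<Omega> (f s) ((\<lambda>t. s + t) -` J) (\<lambda>t. f (s + t))"
proof -
  have eq: "(\<lambda>t. s + t) -` J = (\<lambda>t. - s + t) ` J"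
    by (force simp: image_iff)
  have "is_interval ((\<lambda>t. s + t) -` J)"
    using assms unfolding is_sol_def eq by auto
  moreover have "open ((\<lambda>t. s + t) -` J)"
    using assms open_translation[of J "- s"] unfolding is_sol_def eq by blast
  moreover have "((\<lambda>t. f (s + t)) has_vector_derivative F (f (s + t))) (at t)" if "s + t \<in> J" for t
  proof -
    have "((\<lambda>t. s + t) has_vector_derivative 1) (at t)" by (auto intro!: derivative_eq_intros)
    from vector_diff_chain_at[OF this, of f "F (f (s + t))"] show ?thesis
      using assms that unfolding is_sol_def o_def by auto
  qed
  ultimately show ?thesis using assms unfolding is_sol_def by auto
qed

text \<open>The two intervals overlap in an interval around \<open>s\<close>, on which uniqueness
  forces agreement; near any time the glued function therefore coincides with one of the two
  solutions.\<close>

lemma sol_glue: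
  assumes f: "is_sol F \<Omega> x J f" "s \<in> J" and g: "is_sol F \<Omega> (f s) J' g"
  shows "is_sol F \<Omega> x (J \<union> (\<lambda>t. t - s) -` J') (\<lambda>t. if t \<in> J then f t else g (t - s))"
    (is "is_sol F \<Omega> x ?I ?h")
proof -
  let ?J' = "(\<lambda>t. t - s) -` J'"
  have J: "is_interval J" "open J" "0 \<in> J" "f 0 = x"
    and J5: "\<And>t. t \<in> J \<Longrightarrow> f t \<in> \<Omega> \<and> (f has_vector_derivative F (f t)) (at t)"
    using f unfolding is_sol_def by auto
  have J': "is_interval J'" "open J'" "0 \<in> J'" "g 0 = f s"
    and g5: "\<And>t. t \<in> J' \<Longrightarrow> g t \<in> \<Omega> \<and> (g has_vector_derivative F (g t)) (at t)"
    using g unfolding is_sol_def by auto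
  have eq: "?J' = (\<lambda>t. s + t) ` J'" by (force simp: image_iff)
  have gs: "is_interval ?J'" "open ?J'" "s \<in> ?J'"
    unfolding eq using J' open_translation[of J' s] by (simp, blast, force)
  have gs': "g (t - s) \<in> \<Omega> \<and> ((\<lambda>t. g (t - s)) has_vector_derivative F (g (t - s))) (at t)"
    if t: "t \<in> ?J'" for t
  proof -
    have "((\<lambda>t. t - s) has_vector_derivative 1) (at t)" by (auto intro!: derivative_eq_intros)
    from vector_diff_chain_at[OF this, of g "F (g (t - s))"] show ?thesis
      using g5[of "t - s"] t by (simp add: o_def)
  qed
  have "connected (J \<inter> ?J')"
    using J gs is_interval_connected_1 is_interval_Int by blast
  then have agree: "f t = g (t - s)" if "t \<in> J \<inter> ?J'" for t
    using sol_unique_on[of "J \<inter> ?J'" s f "\<lambda>t. g (t - s)" t] J(2) J5 gs gs' f(2) J'(4) that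
    by (simp add: open_Int)
  define h where "h = ?h"
  define I' where "I' = J \<union> ?J'"
  have hf: "h t = f t" if "t \<in> J" for t unfolding h_def using that by simp
  have hg: "h t = g (t - s)" if "t \<in> ?J'" for t
    unfolding h_def using agree[of t] that by (cases "t \<in> J") auto
  have "connected I'"
    unfolding I'_def using J(1) gs f(2) is_interval_connected_1
    by (intro connected_Un) blast+
  moreover have "open I'" unfolding I'_def using J(2) gs by blast
  moreover have "0 \<in> I'" unfolding I'_def using J(3) by blast
  moreover have "h 0 = x" using hf J(3,4) by simp
  moreover have "h t \<in> \<Omega> \<and> (h has_vector_derivative F (h t)) (at t)" if "t \<in> I'" for t
  proof (cases "t \<in> J")
    case True
    have "(h has_vector_derivative F (f t)) (at t)"
      using J5[OF True] J(2) True hf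
      by (intro has_vector_derivative_transform_within_open[of f "F (f t)" t J h]) simp_all
    then show ?thesis using hf[OF True] J5[OF True] by simp
  next
    case False
    then have t: "t \<in> ?J'" using that I'_def by blast
    have "(h has_vector_derivative F (g (t - s))) (at t)"
    proof (rule has_vector_derivative_transform_within_open)
      show "((\<lambda>t. g (t - s)) has_vector_derivative F (g (t - s))) (at t)" using gs'[OF t] by (rule conjunct2)
      show "open ?J'" by (rule gs)
      show "t \<in> ?J'" by (rule t)
      show "g (u - s) = h u" if "u \<in> ?J'" for u using hg[OF that] by (rule sym)
    qed
    then show ?thesis using hg[OF t] gs'[OF t] by simp
  qed
  ultimately have "is_sol F \<Omega> x I' h" unfolding is_sol_def is_interval_connected_1 by blast
  then show ?thesis unfolding h_def I'_def .
qed

text \<open>Uniqueness makes the choice in \<open>flow\<close> unambiguous, so any solution at hand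
  computes it.\<close>

lemma flow_eq:
  assumes "is_sol F \<Omega> x J f" "t \<in> J"
  shows "flow F \<Omega> t x = f t"
  unfolding flow_def
proof (rule some_equality)
  show "\<exists>J \<phi>. is_sol F \<Omega> x J \<phi> \<and> t \<in> J \<and> \<phi> t = f t" using assms by auto
next
  fix v assume "\<exists>J \<phi>. is_sol F \<Omega> x J \<phi> \<and> t \<in> J \<and> \<phi> t = v"
  then obtain J' g where "is_sol F \<Omega> x J' g" "t \<in> J'" "g t = v" by blast
  then show "v = f t" using sol_unique[OF _ assms(1) _ assms(2)] by blast
qed

lemma sol_subset: "is_sol F \<Omega> x J f \<Longrightarrow> J \<subseteq> ex_ivl F \<Omega> x"
  unfolding ex_ivl_def by blast

text \<open>A union of open intervals through 0 is again one, and near each time the flow coincides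
  with some solution. Local existence is used only to see that this union contains 0.\<close>

lemma flow_sol:
  assumes "x \<in> \<Omega>"
  shows "is_sol F \<Omega> x (ex_ivl F \<Omega> x) (\<lambda>t. flow F \<Omega> t x)"
proof -
  let ?I = "ex_ivl F \<Omega> x" and ?\<phi> = "\<lambda>t. flow F \<Omega> t x"
  have "compact {x}" "{x} \<subseteq> \<Omega>" using assms by auto
  from picard[OF this] obtain r f where r: "0 < r" and f: "csol (ball 0 r) f" "f 0 = x" by blast
  have "is_sol F \<Omega> x {l. of_real l \<in> ball (0::complex) r} (\<lambda>l. f (of_real l))"
    using csol_sol[OF open_ball convex_ball f(1), of 0] r f(2) by simp
  note sol0 = flow_eq[OF this, of 0] sol_subset[OF this]
  have I0: "0 \<in> ?I" "?\<phi> 0 = x"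
    using sol0 r f(2) by auto
  define \<J> where "\<J> = {J. \<exists>\<phi>. is_sol F \<Omega> x J \<phi>}"
  have J: "connected J" "open J" "0 \<in> J" if "J \<in> \<J>" for J
    using that unfolding is_sol_def \<J>_def is_interval_connected_1 by auto
  have "connected (\<Union>\<J>)" by (rule connected_Union) (use J in blast)+
  moreover have "open (\<Union>\<J>)" by (rule open_Union) (use J in blast)
  ultimately have I: "connected ?I" "open ?I" unfolding ex_ivl_def \<J>_def by blast+
  have der: "?\<phi> t \<in> \<Omega> \<and> (?\<phi> has_vector_derivative F (?\<phi> t)) (at t)" if t: "t \<in> ?I" for t
  proof -
    obtain J f where J: "is_sol F \<Omega> x J f" "t \<in> J"
      using t unfolding ex_ivl_def by auto
    then have J': "open J" "f t \<in> \<Omega>" "(f has_vector_derivative F (f t)) (at t)"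
      unfolding is_sol_def by auto
    have "(?\<phi> has_vector_derivative F (f t)) (at t)"
      using has_vector_derivative_transform_within_open[OF J'(3,1) J(2)] flow_eq[OF J(1)] by simp
    then show ?thesis using flow_eq[OF J] J' by simp
  qed
  have "\<forall>t\<in>?I. ?\<phi> t \<in> \<Omega> \<and> (?\<phi> has_vector_derivative F (?\<phi> t)) (at t)"
    using der by blast
  then show ?thesis unfolding is_sol_def is_interval_connected_1 by (intro conjI I0 I)
qed

text \<open>Shifting the solution from \<open>x\<close> gives one starting at
  \<open>flow F \<Omega> s x\<close>; conversely a solution from that point can be glued onto the
  one from \<open>x\<close>. Maximality of both intervals turns this into an equivalence.\<close>

lemma flow_add:
  assumes "x \<in> \<Omega>" "s \<in> ex_ivl F \<Omega> x"
  shows "t \<in> ex_ivl F \<Omega> (flow F \<Omega> s x) \<longleftrightarrow> s + t \<in> ex_ivl F \<Omega> x"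
    and "s + t \<in> ex_ivl F \<Omega> x \<Longrightarrow> flow F \<Omega> t (flow F \<Omega> s x) = flow F \<Omega> (s + t) x"
proof -
  note x = flow_sol[OF assms(1)]
  have y: "flow F \<Omega> s x \<in> \<Omega>" using x assms unfolding is_sol_def by auto
  note sh = sol_shift[OF x assms(2)]
  have "s + t \<in> ex_ivl F \<Omega> x" if "t \<in> ex_ivl F \<Omega> (flow F \<Omega> s x)"
  proof -
    have "s + t - s \<in> ex_ivl F \<Omega> (flow F \<Omega> s x)" using that by simp
    then show ?thesis
      using sol_subset[OF sol_glue[OF x assms(2) flow_sol[OF y]]] by blast
  qed
  then show "t \<in> ex_ivl F \<Omega> (flow F \<Omega> s x) \<longleftrightarrow> s + t \<in> ex_ivl F \<Omega> x"
    using sol_subset[OF sh] by blast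
  show "s + t \<in> ex_ivl F \<Omega> x \<Longrightarrow> flow F \<Omega> t (flow F \<Omega> s x) = flow F \<Omega> (s + t) x"
    by (rule flow_eq[OF sh]) blast
qed

lemma flow_0: "x \<in> \<Omega> \<Longrightarrow> 0 \<in> ex_ivl F \<Omega> x" "x \<in> \<Omega> \<Longrightarrow> flow F \<Omega> 0 x = x"
  using flow_sol unfolding is_sol_def by auto

lemma flow_in_dom: "x \<in> \<Omega> \<Longrightarrow> t \<in> ex_ivl F \<Omega> x \<Longrightarrow> flow F \<Omega> t x \<in> \<Omega>"
  using flow_sol unfolding is_sol_def by auto

lemma ex_ivl_between:
  assumes "x \<in> \<Omega>" "s \<in> ex_ivl F \<Omega> x" "t \<in> ex_ivl F \<Omega> x" "s \<le> u" "u \<le> t"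
  shows "u \<in> ex_ivl F \<Omega> x"
  using flow_sol[OF assms(1)] assms unfolding is_sol_def is_interval_1 by blast

text \<open>From every point of \<open>K\<close> a solution lives at least for time
  \<open>r / 2\<close>, with \<open>r\<close> independent of the point. An orbit that never leaves
  \<open>K\<close> can therefore always be prolonged by the same amount.\<close>

lemma flow_global_pos:
  assumes x: "x \<in> \<Omega>" and K: "compact K" "K \<subseteq> \<Omega>" and sub: "pos_orbit F \<Omega> x \<subseteq> K"
  shows "{0..} \<subseteq> ex_ivl F \<Omega> x"
proof -
  obtain r B where r: "0 < r" and "bounded B"
    and r2: "\<forall>x\<in>K. \<exists>f. csol (ball 0 r) f \<and> f 0 = x \<and> f ` ball 0 r \<subseteq> B"
    using picard[OF K] by (elim exE conjE)
  have half: "r / 2 \<in> ex_ivl F \<Omega> y" if y: "y \<in> K" for y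
  proof -
    obtain f where f: "csol (ball 0 r) f" "f 0 = y" using bspec[OF r2 y] by blast
    have "0 \<in> ball (0::complex) r" using r by simp
    from sol_subset[OF csol_sol[OF open_ball convex_ball f(1) this]] show ?thesis
      using r f(2) by (auto simp: subset_iff)
  qed
  have n: "of_nat n * (r / 2) \<in> ex_ivl F \<Omega> x" for n
  proof (induction n)
    case (Suc n)
    then have "flow F \<Omega> (of_nat n * (r / 2)) x \<in> K"
      using sub r unfolding pos_orbit_def by auto
    then have "of_nat n * (r / 2) + r / 2 \<in> ex_ivl F \<Omega> x"
      using half flow_add(1)[OF x Suc, of "r / 2"] by blast
    moreover have "of_nat (Suc n) * (r / 2) = of_nat n * (r / 2) + r / 2"
      by (simp add: field_simps)
    ultimately show ?case by (simp only:)
  qed (use flow_0 x in auto)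
  show ?thesis
  proof
    fix t :: real assume "t \<in> {0..}"
    moreover obtain n where "t < of_nat n * (r / 2)" using r reals_Archimedean3[of "r / 2"] by auto
    ultimately show "t \<in> ex_ivl F \<Omega> x"
      using ex_ivl_between[OF x n[of 0] n[of n]] by auto
  qed
qed

end

subsection \<open>Bounded orbits in complex time\<close>

text \<open>The edge over time 0 is left out to make the set open. This is why later arguments
  sample the extended solution at time 1 and not at 0.\<close>

definition half_strip :: "real \<Rightarrow> complex set" where
  "half_strip r = {s. 0 < Re s \<and> \<bar>Im s\<bar> < r}"

lemma half_strip_alt: "half_strip r = {s. Re s > 0} \<inter> {s. Im s < r} \<inter> {s. Im s > - r}"
  unfolding half_strip_def by auto

lemma open_half_strip: "open (half_strip r)"
  unfolding half_strip_alt
  by (intro open_Int open_halfspace_Re_gt open_halfspace_Im_lt open_halfspace_Im_gt)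

lemma convex_half_strip: "convex (half_strip r)"
  unfolding half_strip_alt
  by (intro convex_Int convex_halfspace_Re_gt convex_halfspace_Im_lt convex_halfspace_Im_gt)

text \<open>The quotient by a non-real period turns the end of the half strip into a punctured disc.\<close>

lemma nonreal_period_imp_convergent:
  assumes hol: "\<psi> holomorphic_on half_strip r" and bdd: "bounded (\<psi> ` half_strip r)"
    and d: "Im d < 0" "- Im d < r"
    and per: "\<And>s. s \<in> half_strip r \<Longrightarrow> s + d \<in> half_strip r \<Longrightarrow> \<psi> (s + d) = \<psi> s"
  shows "\<exists>L. ((\<lambda>t. \<psi> (complex_of_real t)) \<longlongrightarrow> L) at_top"
proof -
  let ?S = "half_strip r"
  \<comment> \<open>\<open>E\<close> takes equal values exactly at points that differ by an integer
    multiple of \<open>d\<close>, and the sign of \<open>Im d\<close> makes it tend to 0 as the real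
    part grows.\<close>
  define E where "E = (\<lambda>s. exp (2 * of_real pi * \<i> * s / d))"
  have d0: "d \<noteq> 0" using d by auto
  have r: "0 < r" using d by linarith
  have pern: "\<psi> (s + of_nat n * d) = \<psi> s" if "s \<in> ?S" "s + of_nat n * d \<in> ?S" for n s
    using that
  proof (induction n arbitrary: s)
    case (Suc n)
    \<comment> \<open>\<open>s + d\<close> lies on the segment from \<open>s\<close> to
      \<open>s + of_nat (Suc n) * d\<close>, hence in the convex strip, so a period can be split off
      without leaving it.\<close>
    define u where "u = 1 / real (Suc n)"
    have u: "0 \<le> u" "0 \<le> 1 - u" "u * real (Suc n) = 1" unfolding u_def by auto
    have "(1 - u) *\<^sub>R s + u *\<^sub>R (s + of_nat (Suc n) * d) = s + (of_real (u * real (Suc n))) * d"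
      by (simp add: scaleR_conv_of_real algebra_simps)
    then have "s + d = (1 - u) *\<^sub>R s + u *\<^sub>R (s + of_nat (Suc n) * d)"
      unfolding u(3) by simp
    then have sd: "s + d \<in> ?S"
      using convexD[OF convex_half_strip Suc.prems u(2,1)] by simp
    have eq: "s + of_nat (Suc n) * d = (s + d) + of_nat n * d" by (simp add: algebra_simps)
    show ?case
      using Suc.IH[OF sd] Suc.prems(2) per[OF Suc.prems(1) sd] unfolding eq by simp
  qed auto
  have perE: "\<psi> s = \<psi> s'" if "s \<in> ?S" "s' \<in> ?S" "E s = E s'" for s s'
  proof -
    obtain n :: int where "2 * of_real pi * \<i> * s / d = 2 * of_real pi * \<i> * s' / d + of_real (of_int (2 * n) * pi) * \<i>"
      using \<open>E s = E s'\<close> unfolding E_def exp_eq by blast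
    then have "2 * of_real pi * \<i> * s = 2 * of_real pi * \<i> * (s' + of_int n * d)"
      using d0 by (simp add: field_simps)
    then have n: "s = s' + of_int n * d" by (simp add: mult_left_cancel)
    show ?thesis
    proof (cases "n \<ge> 0")
      case True
      then have "s = s' + of_nat (nat n) * d" using n by simp
      then show ?thesis using pern that by metis
    next
      case False
      then have "of_int n = - (of_nat (nat (- n)) :: complex)" by simp
      then have "s' = s + of_nat (nat (- n)) * d" using n by (simp add: algebra_simps)
      then show ?thesis using pern that by metis
    qed
  qed
  have normE: "norm (E s) = exp (2 * pi * (Im d * Re s - Re d * Im s) / (norm d)\<^sup>2)" for s
  proof -
    have "Re (2 * of_real pi * \<i> * s / d) = 2 * pi * (Im d * Re s - Re d * Im s) / (norm d)\<^sup>2"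
    proof -
      have "2 * of_real pi * \<i> * s / d = (2 * of_real pi * \<i> * s * cnj d) / of_real ((norm d)\<^sup>2)"
        using complex_div_cnj[of "2 * of_real pi * \<i> * s" d] by simp
      then have "Re (2 * of_real pi * \<i> * s / d) = Re (2 * of_real pi * \<i> * s * cnj d) / (norm d)\<^sup>2"
        by (simp only: Re_divide_of_real)
      also have "Re (2 * of_real pi * \<i> * s * cnj d) = 2 * pi * (Im d * Re s - Re d * Im s)"
        by (simp add: algebra_simps)
      finally show ?thesis .
    qed
    then show ?thesis unfolding E_def by simp
  qed
  \<comment> \<open>This radius is chosen so that \<open>norm (E s) < \<rho>\<close> together with
    \<open>\<bar>Im s\<bar> < r\<close> forces \<open>Re s > 0\<close>, that is, \<open>s\<close> in
    the strip.\<close>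
  define \<rho> where "\<rho> = exp (- (2 * pi * (\<bar>Re d\<bar> * r) / (norm d)\<^sup>2))"
  have \<rho>: "0 < \<rho>" unfolding \<rho>_def by simp
  have ex: "\<exists>s\<in>?S. E s = z" if z: "0 < norm z" "norm z < \<rho>" for z
  proof -
    define s1 where "s1 = d * Ln z / (2 * of_real pi * \<i>)"
    \<comment> \<open>Rounding selects the translate of \<open>s1\<close> with imaginary part at
      most half of \<open>\<bar>Im d\<bar>\<close>, which is below \<open>r\<close>.\<close>
    define n where "n = round (- Im s1 / Im d)"
    define s where "s = s1 + of_int n * d"
    have Es: "E s = z"
    proof -
      have "2 * of_real pi * \<i> * s / d = Ln z + of_real (of_int (2 * n) * pi) * \<i>"
        unfolding s_def s1_def using d0 by (simp add: field_simps)
      then show ?thesis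
        unfolding E_def using z exp_eq[of "Ln z + of_real (of_int (2 * n) * pi) * \<i>" "Ln z"] by auto
    qed
    have "\<bar>of_int n - (- Im s1 / Im d)\<bar> \<le> 1 / 2"
      unfolding n_def using of_int_round_abs_le by blast
    moreover have "Im s = (of_int n - (- Im s1 / Im d)) * Im d"
      unfolding s_def using d by (simp add: field_simps)
    ultimately have "\<bar>Im s\<bar> \<le> 1 / 2 * \<bar>Im d\<bar>"
      by (simp only: abs_mult) (intro mult_right_mono, auto)
    then have Im: "\<bar>Im s\<bar> < r" using d by linarith
    have "2 * pi * (Im d * Re s - Re d * Im s) / (norm d)\<^sup>2 < - (2 * pi * (\<bar>Re d\<bar> * r) / (norm d)\<^sup>2)"
      using z(2) unfolding Es[symmetric] normE \<rho>_def by simp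
    then have "2 * pi * (Im d * Re s - Re d * Im s) / (norm d)\<^sup>2 < 2 * pi * (- (\<bar>Re d\<bar> * r)) / (norm d)\<^sup>2"
      by simp
    then have "2 * pi * (Im d * Re s - Re d * Im s) < 2 * pi * (- (\<bar>Re d\<bar> * r))"
      using d0 by (subst (asm) divide_less_cancel) auto
    then have "Im d * Re s - Re d * Im s < - (\<bar>Re d\<bar> * r)"
      by (rule mult_left_less_imp_less) simp
    moreover have "\<bar>Re d * Im s\<bar> \<le> \<bar>Re d\<bar> * r"
      using Im by (simp add: abs_mult mult_left_mono)
    ultimately have "Im d * Re s < 0" by linarith
    then have "0 < Re s" using d by (simp add: mult_less_0_iff)
    then show ?thesis using Im Es unfolding half_strip_def by blast
  qed
  \<comment> \<open>\<psi> descends to the quotient: by \<open>perE\<close> its value does not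
    depend on the preimage selected.\<close>
  define h where "h = (\<lambda>z. \<psi> (SOME s. s \<in> ?S \<and> E s = z))"
  have h: "h (E s) = \<psi> s" if "s \<in> ?S" for s
  proof -
    have "(SOME s'. s' \<in> ?S \<and> E s' = E s) \<in> ?S \<and> E (SOME s'. s' \<in> ?S \<and> E s' = E s) = E s"
      by (rule someI[of "\<lambda>s'. s' \<in> ?S \<and> E s' = E s" s]) (use that in simp)
    then show ?thesis unfolding h_def using perE that by blast
  qed
  have hol_h: "h holomorphic_on ball 0 \<rho> - {0}"
  proof -
    have "h field_differentiable (at z0)" if "z0 \<in> ball 0 \<rho> - {0}" for z0
    proof -
      obtain s0 where s0: "s0 \<in> ?S" "E s0 = z0" using ex[of z0] \<open>z0 \<in> _\<close> by auto
      have z0: "z0 \<noteq> 0" using that by auto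
      \<comment> \<open>The branch of the inverse of \<open>E\<close> that takes \<open>z0\<close>
        to \<open>s0\<close>, holomorphic on \<open>W\<close>; it exhibits \<open>h\<close> near
        \<open>z0\<close> as \<psi> after a holomorphic map.\<close>
      define \<sigma> where "\<sigma> = (\<lambda>z. s0 + d / (2 * of_real pi * \<i>) * Ln (z / z0))"
      define W where "W = (\<lambda>z. z / z0) -` (- \<real>\<^sub>\<le>\<^sub>0)"
      have W: "open W" "z0 \<in> W"
        unfolding W_def using z0 by (auto intro!: open_vimage continuous_intros)
      have \<sigma>: "\<sigma> holomorphic_on W"
        unfolding \<sigma>_def W_def using z0 by (auto intro!: holomorphic_intros)
      have \<sigma>0: "\<sigma> z0 = s0" unfolding \<sigma>_def using z0 by simp
      define U where "U = \<sigma> -` ?S \<inter> W"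
      have U: "open U" "z0 \<in> U"
        using continuous_on_open_vimage[OF W(1)] holomorphic_on_imp_continuous_on[OF \<sigma>] open_half_strip
          W(2) s0(1) \<sigma>0 unfolding U_def by auto
      have "(\<psi> \<circ> \<sigma>) holomorphic_on U"
        by (rule holomorphic_on_compose_gen[OF holomorphic_on_subset[OF \<sigma>] hol]) (auto simp: U_def)
      moreover have "h z = (\<psi> \<circ> \<sigma>) z" if "z \<in> U" for z
      proof -
        have z: "z / z0 \<notin> \<real>\<^sub>\<le>\<^sub>0" "\<sigma> z \<in> ?S" using that unfolding U_def W_def by auto
        then have "z / z0 \<noteq> 0" by auto
        then have zn: "z \<noteq> 0" by auto
        have "2 * of_real pi * \<i> * \<sigma> z / d = 2 * of_real pi * \<i> * s0 / d + Ln (z / z0)"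
          unfolding \<sigma>_def using d0 by (simp add: field_simps)
        then have "E (\<sigma> z) = E s0 * exp (Ln (z / z0))"
          unfolding E_def by (simp add: exp_add)
        then have "E (\<sigma> z) = z" using s0(2) z0 zn by simp
        then show ?thesis using h[OF z(2)] by simp
      qed
      ultimately have "h holomorphic_on U" using holomorphic_transform by metis
      then show ?thesis using U holomorphic_on_imp_differentiable_at by blast
    qed
    then show ?thesis unfolding holomorphic_on_def using field_differentiable_at_within by blast
  qed
  obtain M where M: "\<And>s. s \<in> ?S \<Longrightarrow> norm (\<psi> s) \<le> M"
    using bdd unfolding bounded_iff by auto
  have "eventually (\<lambda>z. z \<in> ball 0 \<rho> - {0}) (at (0::complex))"
    using \<rho> eventually_at_in_open by (metis centre_in_ball open_ball)
  then have "eventually (\<lambda>z. norm (h z) \<le> M) (at 0)"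
  proof eventually_elim
    case (elim z)
    then obtain s where "s \<in> ?S" "E s = z" using ex[of z] by auto
    then show ?case using h M by metis
  qed
  then obtain g where g: "g holomorphic_on ball 0 \<rho>" "\<And>z. z \<in> ball 0 \<rho> - {0} \<Longrightarrow> g z = h z"
    using holomorphic_on_extend_bounded[OF hol_h] \<rho> by auto
  have Et: "((\<lambda>t. E (of_real t)) \<longlongrightarrow> 0) at_top"
  proof (rule tendsto_norm_zero_cancel)
    have "2 * pi * Im d / (norm d)\<^sup>2 < 0" using d d0 by (simp add: divide_neg_pos mult_pos_neg)
    then have "((\<lambda>t. exp ((2 * pi * Im d / (norm d)\<^sup>2) * t)) \<longlongrightarrow> 0) at_top"
      by (intro filterlim_compose[OF exp_at_bot] filterlim_tendsto_neg_mult_at_bot[OF tendsto_const _ filterlim_ident])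
    then show "((\<lambda>t. norm (E (of_real t))) \<longlongrightarrow> 0) at_top"
      unfolding normE by (simp add: mult.commute mult.left_commute)
  qed
  have "isCont g 0"
    using g(1) \<rho> by (metis centre_in_ball continuous_on_eq_continuous_at holomorphic_on_imp_continuous_on open_ball)
  then have "((\<lambda>t. g (E (of_real t))) \<longlongrightarrow> g 0) at_top"
    using Et isCont_tendsto_compose by blast
  moreover have "eventually (\<lambda>t. g (E (of_real t)) = \<psi> (of_real t)) at_top"
  proof -
    have "eventually (\<lambda>t. E (of_real t) \<in> ball 0 \<rho>) at_top"
      by (rule topological_tendstoD[OF Et open_ball]) (use \<rho> in simp)
    then show ?thesis
      using eventually_gt_at_top[of 0]
    proof eventually_elim
      case (elim t)
      then have "complex_of_real t \<in> ?S" using r unfolding half_strip_def by simp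
      moreover have "E (of_real t) \<noteq> 0" unfolding E_def by simp
      ultimately show ?case using g(2) h elim by simp
    qed
  qed
  ultimately have "((\<lambda>t. \<psi> (of_real t)) \<longlongrightarrow> g 0) at_top"
    by (rule Lim_transform_eventually)
  then show ?thesis by (rule exI)
qed

section \<open>Periods of complex solutions and extension of real solutions to a half strip\<close>

context holo_field
begin

text \<open>A single coincidence suffices: \<psi> and its translate by \<open>d\<close> both solve
  the equation on the convex set where both are defined, and they agree at
  \<open>s1\<close>.\<close>

lemma csol_period:
  assumes S: "open S" "convex S" and \<psi>: "csol S \<psi>"
    and s: "s1 \<in> S" "s1 + d \<in> S" "\<psi> (s1 + d) = \<psi> s1" and t: "s \<in> S" "s + d \<in> S"
  shows "\<psi> (s + d) = \<psi> s"
proof -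
  let ?A = "S \<inter> (\<lambda>s. s + d) -` S"
  have eq: "(\<lambda>s. s + d) -` S = (\<lambda>s. - d + s) ` S" by (force simp: image_iff)
  have A: "open ?A" "convex ?A"
    using S open_translation[of S "- d"] convex_translation[OF S(2), of "- d"]
    unfolding eq by (blast, intro convex_Int)
  show ?thesis
  proof (rule csol_unique[OF A, of "\<lambda>s. \<psi> (s + d)" \<psi> s1])
    show "csol ?A (\<lambda>s. \<psi> (s + d))" by (rule csol_shift[OF \<psi>]) blast
    show "csol ?A \<psi>" by (rule csol_subset[OF \<psi>]) blast
  qed (use s t in auto)
qed

text \<open>Each point of the orbit launches a complex solution on a disc of one fixed radius. These
  discs, centred at the nonnegative real times, cover the strip, and by uniqueness the local
  solutions fit together.\<close>

lemma real_sol_to_strip: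
  assumes \<phi>: "is_sol F \<Omega> x J \<phi>" "{0..} \<subseteq> J" and K: "compact K" "K \<subseteq> \<Omega>"
    and inK: "\<forall>t\<ge>0. \<phi> t \<in> K"
  shows "\<exists>r>0. \<exists>\<psi>. csol (half_strip r) \<psi> \<and> bounded (\<psi> ` half_strip r) \<and>
    (\<forall>t>0. \<psi> (of_real t) = \<phi> t)"
proof -
  obtain r B where r: "0 < r" and B: "bounded B"
    and ex: "\<forall>x\<in>K. \<exists>f. csol (ball 0 r) f \<and> f 0 = x \<and> f ` ball 0 r \<subseteq> B"
    using picard[OF K] by (elim exE conjE)
  have "\<forall>t\<in>{0..}. \<exists>f. csol (ball 0 r) f \<and> f 0 = \<phi> t \<and> f ` ball 0 r \<subseteq> B"
    using ex inK by simp
  then obtain f where f: "\<And>t. 0 \<le> t \<Longrightarrow> csol (ball 0 r) (f t)"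
    "\<And>t. 0 \<le> t \<Longrightarrow> f t 0 = \<phi> t" "\<And>t. 0 \<le> t \<Longrightarrow> f t ` ball 0 r \<subseteq> B"
    unfolding bchoice_iff by auto
  have f_real: "f t0 (of_real (t - t0)) = \<phi> t" if t: "0 \<le> t0" "0 \<le> t" "\<bar>t - t0\<bar> < r" for t t0
  proof -
    have "0 \<in> ball (0::complex) r" using r by simp
    from csol_sol[OF open_ball convex_ball f(1)[OF t(1)] this]
    have 1: "is_sol F \<Omega> (\<phi> t0) {l. of_real l \<in> ball (0::complex) r} (\<lambda>l. f t0 (of_real l))"
      using f(2)[OF t(1)] by simp
    have t0: "t0 \<in> J" using \<phi>(2) t(1) by auto
    have tJ: "t \<in> J" using \<phi>(2) t(2) by auto
    have "(\<lambda>l. f t0 (complex_of_real l)) (t - t0) = (\<lambda>l. \<phi> (t0 + l)) (t - t0)"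
      by (rule sol_unique[OF 1 sol_shift[OF \<phi>(1) t0]]) (use t tJ in \<open>auto simp: dist_norm simp flip: of_real_diff\<close>)
    then show ?thesis by simp
  qed
  \<comment> \<open>The value at \<open>s\<close> is read vertically above \<open>Re s\<close>, from
    a disc that changes with \<open>s\<close>. Differentiability is therefore not visible until
    \<open>local_eq\<close> replaces these discs by a single one near each real time.\<close>
  define \<psi> where "\<psi> = (\<lambda>s. f (Re s) (\<i> * of_real (Im s)))"
  have local_eq: "\<psi> s = f t0 (s - of_real t0)"
    if t0: "0 < t0" and s: "norm (s - of_real t0) < r" "0 < Re s" for s t0
  proof -
    define d where "d = complex_of_real (Re s - t0)"
    \<comment> \<open>The lens on which \<open>f (Re s)\<close> and the translate of
      \<open>f t0\<close> by \<open>d\<close> are both defined; at its point 0 both take the value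
      \<open>\<phi> (Re s)\<close>.\<close>
    let ?A = "ball (0::complex) r \<inter> ball (- d) r"
    have "\<bar>Re (s - of_real t0)\<bar> \<le> norm (s - of_real t0)" "\<bar>Im (s - of_real t0)\<bar> \<le> norm (s - of_real t0)"
      by (rule abs_Re_le_cmod, rule abs_Im_le_cmod)
    then have b: "\<bar>Re s - t0\<bar> < r" "\<bar>Im s\<bar> < r" using s by auto
    have sd: "\<i> * of_real (Im s) + d = s - of_real t0"
      unfolding d_def by (simp add: complex_eq_iff)
    have "f (Re s) (\<i> * of_real (Im s)) = f t0 (\<i> * of_real (Im s) + d)"
    proof (rule csol_unique[of ?A "f (Re s)" "\<lambda>u. f t0 (u + d)" 0])
      show "csol ?A (f (Re s))" by (rule csol_subset[OF f(1)]) (use s in auto)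
      show "csol ?A (\<lambda>u. f t0 (u + d))"
      proof (rule csol_shift[OF f(1)])
        fix u assume "u \<in> ?A"
        then have "norm (- d - u) < r" by (simp add: dist_norm)
        then show "u + d \<in> ball 0 r" by (simp add: norm_minus_commute add.commute)
      qed (use t0 in simp)
      show "f (Re s) 0 = f t0 (0 + d)"
        using f(2)[of "Re s"] f_real[of t0 "Re s"] s t0 b unfolding d_def by simp
      have "norm (- d - \<i> * of_real (Im s)) = norm (s - of_real t0)"
        unfolding sd[symmetric] by (metis add.commute minus_diff_eq norm_minus_cancel minus_add_distrib uminus_add_conv_diff add_uminus_conv_diff)
      then show "\<i> * of_real (Im s) \<in> ?A"
        using s b by (simp add: dist_norm norm_mult)
      show "0 \<in> ?A" using r b unfolding d_def by (simp del: of_real_diff)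
    qed (intro open_Int convex_Int open_ball convex_ball)+
    then show ?thesis unfolding \<psi>_def sd .
  qed
  have "csol (half_strip r) \<psi>"
    unfolding csol_def
  proof
    fix s0 assume s0: "s0 \<in> half_strip r"
    define t0 where "t0 = Re s0"
    have t0: "0 < t0" using s0 unfolding t0_def half_strip_def by simp
    define N where "N = ball (complex_of_real t0) r \<inter> {s. Re s > 0}"
    have N: "open N" unfolding N_def by (intro open_Int open_ball open_halfspace_Re_gt)
    have "s0 - of_real t0 = \<i> * of_real (Im s0)" unfolding t0_def by (simp add: complex_eq_iff)
    then have n0: "norm (s0 - of_real t0) < r" using s0 by (simp add: norm_mult half_strip_def)
    then have s0N: "s0 \<in> N"
      using t0 unfolding N_def by (simp add: dist_norm norm_minus_commute) (simp add: t0_def)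
    have eqN: "f t0 (s + - of_real t0) = \<psi> s" if "s \<in> N" for s
      using local_eq[OF t0, of s] that unfolding N_def by (simp add: dist_norm norm_minus_commute)
    have "csol N (\<lambda>s. f t0 (s + - of_real t0))"
      by (rule csol_shift[OF f(1)]) (use t0 in \<open>auto simp: N_def dist_norm norm_minus_commute\<close>)
    then have "f t0 (s0 + - of_real t0) \<in> \<Omega>"
      "((\<lambda>s. f t0 (s + - of_real t0)) has_field_derivative F (f t0 (s0 + - of_real t0))) (at s0)"
      using s0N unfolding csol_def by blast+
    note f0 = this
    have "(\<psi> has_field_derivative F (f t0 (s0 + - of_real t0))) (at s0)"
      by (rule has_field_derivative_transform_within_open[OF f0(2) N s0N eqN])
    then show "\<psi> s0 \<in> \<Omega> \<and> (\<psi> has_field_derivative F (\<psi> s0)) (at s0)"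
      using f0(1) unfolding eqN[OF s0N] by (rule conjI[rotated])
  qed
  moreover have "\<psi> ` half_strip r \<subseteq> B"
  proof
    fix z assume "z \<in> \<psi> ` half_strip r"
    then obtain s where s: "s \<in> half_strip r" "z = \<psi> s" by blast
    then have "\<i> * of_real (Im s) \<in> ball 0 r" "0 \<le> Re s"
      unfolding half_strip_def by (auto simp: norm_mult)
    then show "z \<in> B" using f(3)[of "Re s"] s unfolding \<psi>_def by blast
  qed
  moreover have "\<psi> (of_real t) = \<phi> t" if "0 < t" for t
    using f(2)[of t] that unfolding \<psi>_def by simp
  ultimately show ?thesis using r bounded_subset[OF B] by blast
qed

subsection \<open>Limit points of bounded orbits\<close>

text \<open>If \<open>F L\<close> were nonzero, the displacement over a late unit of time would stay
  within half of \<open>norm (F L)\<close> of \<open>F L\<close>, while convergence makes that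
  displacement tend to 0. Subtracting the uniform motion with velocity \<open>F L\<close> gives
  \<open>g\<close>, to which the mean value bound applies.\<close>

lemma limit_is_equilibrium:
  assumes \<phi>: "is_sol F \<Omega> x J \<phi>" "{0..} \<subseteq> J" and L: "(\<phi> \<longlongrightarrow> L) at_top" "L \<in> \<Omega>"
  shows "F L = 0"
proof (rule ccontr)
  assume nz: "F L \<noteq> 0"
  define e where "e = norm (F L) / 2"
  have e: "0 < e" unfolding e_def using nz by simp
  have "isCont F L"
    using field_continuous L(2) open_dom continuous_on_eq_continuous_at by blast
  then have "((\<lambda>t. F (\<phi> t)) \<longlongrightarrow> F L) at_top"
    using L(1) isCont_tendsto_compose by blast
  then have 1: "eventually (\<lambda>t. dist (F (\<phi> t)) (F L) < e) at_top"
    using e tendstoD by blast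
  have "((\<lambda>t. \<phi> (t + 1)) \<longlongrightarrow> L) at_top"
    using filterlim_compose[OF L(1)] filterlim_tendsto_add_at_top[OF tendsto_const filterlim_ident, of 1]
    by (simp add: add.commute)
  from tendsto_diff[OF this L(1)] have 2: "eventually (\<lambda>t. dist (\<phi> (t + 1) - \<phi> t) 0 < e) at_top"
    using e tendstoD by fastforce
  from eventually_happens'[OF _ eventually_conj[OF eventually_all_ge_at_top[OF 1] eventually_conj[OF 2 eventually_ge_at_top[of 0]]]]
  obtain t where t: "\<And>u. t \<le> u \<Longrightarrow> dist (F (\<phi> u)) (F L) < e" "dist (\<phi> (t + 1) - \<phi> t) 0 < e" "0 \<le> t"
    by auto
  define g where "g = (\<lambda>u. \<phi> u - of_real u * F L)"
  have "norm (g (t + 1) - g t) \<le> e * norm ((t + 1) - t)"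
  proof (rule differentiable_bound[of "{t..t+1}" g "\<lambda>u l. l *\<^sub>R (F (\<phi> u) - F L)"])
    fix u assume u: "u \<in> {t..t+1}"
    then have "u \<in> J" using \<phi>(2) t(3) by auto
    then have "(\<phi> has_vector_derivative F (\<phi> u)) (at u)"
      using \<phi>(1) unfolding is_sol_def by blast
    then have "(g has_vector_derivative (F (\<phi> u) - F L)) (at u)"
      unfolding g_def by (auto intro!: derivative_eq_intros)
    then show "(g has_derivative (\<lambda>l. l *\<^sub>R (F (\<phi> u) - F L))) (at u within {t..t+1})"
      using has_vector_derivative_at_within has_vector_derivative_def by blast
    show "onorm (\<lambda>l. l *\<^sub>R (F (\<phi> u) - F L)) \<le> e"
      using t(1)[of u] u by (simp add: onorm_scaleR_left[OF bounded_linear_ident] onorm_id dist_norm)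
  qed auto
  then have "norm ((\<phi> (t + 1) - \<phi> t) - F L) \<le> e"
    unfolding g_def by (simp add: algebra_simps)
  then have "norm (F L) < e + e"
    using t(2) norm_triangle_ineq4[of "\<phi> (t + 1) - \<phi> t" "(\<phi> (t + 1) - \<phi> t) - F L"] by simp
  then show False unfolding e_def by simp
qed

text \<open>The period found far out belongs to \<psi> on the whole strip, so the starting point
  itself returns and not just some late point of the orbit.\<close>

lemma regular_limit_point_recurrent:
  assumes \<phi>: "is_sol F \<Omega> x J \<phi>" "{0..} \<subseteq> J" and K: "compact K" "K \<subseteq> \<Omega>"
    and inK: "\<forall>t\<ge>0. \<phi> t \<in> K"
    and p: "p \<in> \<Omega>" "F p \<noteq> 0"
    and tk: "filterlim tk at_top sequentially" "(\<lambda>k. \<phi> (tk k)) \<longlonglongrightarrow> p"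
  shows "\<exists>T>0. \<phi> T = x"
proof -
  obtain r \<psi> where r: "0 < r" and \<psi>: "csol (half_strip r) \<psi>" and bdd: "bounded (\<psi> ` half_strip r)"
    and \<psi>\<phi>: "\<forall>t>0. \<psi> (of_real t) = \<phi> t"
    using real_sol_to_strip[OF \<phi> K inK] by (elim exE conjE)
  have "compact {p}" "{p} \<subseteq> \<Omega>" using p by auto
  from picard[OF this] obtain r1 f where r1: "0 < r1" and f: "csol (ball 0 r1) f" "f 0 = p" by blast
  \<comment> \<open>A quarter of the width leaves room for two corrections at once: the shifted disc
    stays in the strip, and the period \<open>d\<close> has imaginary part below \<open>r\<close> in
    absolute value.\<close>
  define r2 where "r2 = min r1 (r / 4)"
  have r2: "0 < r2" "r2 \<le> r1" "r2 \<le> r / 4" unfolding r2_def using r r1 by auto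
  have f2: "csol (ball 0 r2) f" by (rule csol_subset[OF f(1)]) (use r2 in auto)
  have "(f has_field_derivative F p) (at 0)"
    using f2 r2(1) f(2) unfolding csol_def by (metis centre_in_ball)
  then have "deriv f 0 \<noteq> 0" using p(2) DERIV_imp_deriv by metis
  then obtain e where e: "e > 0" "ball 0 e \<subseteq> ball (0::complex) r2" "open (f ` ball 0 e)"
    using has_complex_derivative_locally_invertible[OF csol_holomorphic[OF f2], of 0] r2(1)
    by (metis centre_in_ball open_ball)
  have "p \<in> f ` ball 0 e" using e(1) f(2) by (metis centre_in_ball imageI)
  then have ev: "eventually (\<lambda>k. \<phi> (tk k) \<in> f ` ball 0 e) sequentially"
    using topological_tendstoD[OF tk(2) e(3)] by blast
  \<comment> \<open>A position close to \<open>p\<close> is \<open>f s\<close> for a small complex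
    time \<open>s\<close>, because \<open>f\<close> is locally invertible at 0; running back by
    \<open>s\<close> lands exactly on \<open>p\<close>.\<close>
  have hit: "\<exists>s. norm s < r / 4 \<and> of_real t - s \<in> half_strip r \<and> \<psi> (of_real t - s) = p"
    if t: "r < t" "\<phi> t \<in> f ` ball 0 e" for t
  proof -
    obtain s where s: "s \<in> ball 0 e" "\<phi> t = f s" using t(2) by blast
    then have s2: "s \<in> ball 0 r2" using e(2) by blast
    then have sr: "norm s < r / 4" using r2(3) by simp
    have in_strip: "u + (of_real t - s) \<in> half_strip r" if "u \<in> ball 0 r2" for u
    proof -
      have "norm u < r / 4" using that r2(3) by simp
      then have "\<bar>Re u\<bar> < r / 4" "\<bar>Im u\<bar> < r / 4" "\<bar>Re s\<bar> < r / 4" "\<bar>Im s\<bar> < r / 4"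
        using sr abs_Re_le_cmod abs_Im_le_cmod by (meson le_less_trans)+
      then show ?thesis using t(1) unfolding half_strip_def by auto
    qed
    have "\<psi> (0 + (of_real t - s)) = f 0"
    proof (rule csol_unique[OF open_ball convex_ball, of 0 r2 "\<lambda>u. \<psi> (u + (of_real t - s))" f s])
      show "csol (ball 0 r2) (\<lambda>u. \<psi> (u + (of_real t - s)))"
        by (rule csol_shift[OF \<psi>]) (rule in_strip)
      show "\<psi> (s + (of_real t - s)) = f s" using \<psi>\<phi> t r s(2) by simp
    qed (use f2 s2 r2(1) in auto)
    then show ?thesis using sr in_strip[of 0] r2(1) f(2) by (intro exI[of _ s]) simp
  qed
  obtain k1 where k1: "r < tk k1" "\<phi> (tk k1) \<in> f ` ball 0 e"
    using eventually_happens'[OF _ eventually_conj[OF ev filterlim_at_top_dense[THEN iffD1, OF tk(1), rule_format, of r]]]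
    by auto
  \<comment> \<open>The extra delay \<open>r\<close> outweighs the corrections \<open>s1\<close> and
    \<open>s2\<close>, so the period has positive real part.\<close>
  obtain k2 where k2: "tk k1 + r < tk k2" "\<phi> (tk k2) \<in> f ` ball 0 e"
    using eventually_happens'[OF _ eventually_conj[OF ev filterlim_at_top_dense[THEN iffD1, OF tk(1), rule_format, of "tk k1 + r"]]]
    by auto
  obtain s1 where s1: "norm s1 < r / 4" "of_real (tk k1) - s1 \<in> half_strip r" "\<psi> (of_real (tk k1) - s1) = p"
    using hit[OF k1] by blast
  obtain s2 where s2: "norm s2 < r / 4" "of_real (tk k2) - s2 \<in> half_strip r" "\<psi> (of_real (tk k2) - s2) = p"
    using hit[OF _ k2(2)] k1(1) k2(1) r by auto
  define d where "d = (of_real (tk k2) - s2) - (of_real (tk k1) - s1)"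
  have "\<bar>Re s1\<bar> < r / 4" "\<bar>Im s1\<bar> < r / 4" "\<bar>Re s2\<bar> < r / 4" "\<bar>Im s2\<bar> < r / 4"
    using s1 s2 abs_Re_le_cmod abs_Im_le_cmod by (meson le_less_trans)+
  then have d: "0 < Re d" "\<bar>Im d\<bar> < r" unfolding d_def using k2(1) by auto
  have per: "\<psi> (s + d) = \<psi> s" if "s \<in> half_strip r" "s + d \<in> half_strip r" for s
    by (rule csol_period[OF open_half_strip convex_half_strip \<psi> _ _ _ that, of "of_real (tk k1) - s1"])
       (use s1 s2 in \<open>simp_all add: d_def\<close>)
  have "Im d = 0"
  proof (rule ccontr)
    assume nz: "Im d \<noteq> 0"
    have "\<exists>d'. Im d' < 0 \<and> - Im d' < r \<and>
        (\<forall>s. s \<in> half_strip r \<longrightarrow> s + d' \<in> half_strip r \<longrightarrow> \<psi> (s + d') = \<psi> s)"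
    \<comment> \<open>The negative of a period is a period, so the sign demanded by the quotient
      construction can be arranged.\<close>
    proof (cases "Im d < 0")
      case True then show ?thesis using d per by (intro exI[of _ d]) auto
    next
      case False
      have "\<psi> (s + - d) = \<psi> s" if "s \<in> half_strip r" "s + - d \<in> half_strip r" for s
        using per[OF that(2)] that(1) by simp
      then show ?thesis using d nz False by (intro exI[of _ "- d"]) auto
    qed
    then obtain d' where d': "Im d' < 0" "- Im d' < r"
      "\<And>s. s \<in> half_strip r \<Longrightarrow> s + d' \<in> half_strip r \<Longrightarrow> \<psi> (s + d') = \<psi> s" by blast
    have "\<exists>L. ((\<lambda>t. \<psi> (complex_of_real t)) \<longlongrightarrow> L) at_top"
      by (rule nonreal_period_imp_convergent[OF csol_holomorphic[OF \<psi>] bdd d'(1,2)]) (rule d'(3))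
    then obtain L where L: "((\<lambda>t. \<psi> (complex_of_real t)) \<longlongrightarrow> L) at_top" by blast
    have "(\<phi> \<longlongrightarrow> L) at_top"
      by (rule Lim_transform_eventually[OF L]) (rule eventually_mono[OF eventually_gt_at_top[of 0]], use \<psi>\<phi> in blast)
    moreover from this have "(\<lambda>k. \<phi> (tk k)) \<longlonglongrightarrow> L"
      using filterlim_compose tk(1) by blast
    then have "L = p" using tk(2) LIMSEQ_unique by blast
    ultimately show False using limit_is_equilibrium[OF \<phi>] p by blast
  qed
  define T where "T = Re d"
  have T: "d = of_real T" "0 < T" using \<open>Im d = 0\<close> d unfolding T_def by (auto simp: complex_eq_iff)
  \<comment> \<open>Time 0 is not in the strip. The coincidence is read off at times 1 and
    \<open>1 + T\<close> and then carried back by one unit through real uniqueness.\<close>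
  have "\<psi> (1 + d) = \<psi> 1"
    by (rule per) (use r T in \<open>auto simp: half_strip_def\<close>)
  then have "\<phi> (1 + T) = \<phi> 1"
    using \<psi>\<phi>[rule_format, of 1] \<psi>\<phi>[rule_format, of "1 + T"] T by simp
  moreover have J: "1 \<in> J" "1 + T \<in> J" "T \<in> J" "0 \<in> J" using \<phi>(2) T(2) by auto
  ultimately have "\<phi> (1 + T + - 1) = \<phi> (1 + - 1)"
    using sol_unique[OF sol_shift[OF \<phi>(1) J(2)], of _ "\<lambda>t. \<phi> (1 + t)" "- 1"] sol_shift[OF \<phi>(1) J(1)]
    by auto
  then have "\<phi> T = x" using \<phi>(1) unfolding is_sol_def by simp
  then show ?thesis using T(2) by blast
qed

end

text \<open>Since equilibria are isolated, a curve with two limit points would accumulate on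
  a small circle around one of them, which carries no equilibria.\<close>

lemma no_regular_limit_point_imp_convergent:
  fixes F :: "complex \<Rightarrow> complex" and \<phi> :: "real \<Rightarrow> complex"
  assumes F: "F holomorphic_on \<Omega>" "open \<Omega>" "connected \<Omega>" "\<exists>z\<in>\<Omega>. F z \<noteq> 0"
    and cont: "continuous_on {0..} \<phi>" and K: "compact K" "K \<subseteq> \<Omega>"
    and inK: "\<forall>t\<ge>0. \<phi> t \<in> K"
    and eq: "\<And>p tk. p \<in> K \<Longrightarrow> filterlim tk at_top sequentially \<Longrightarrow> (\<lambda>k. \<phi> (tk k)) \<longlonglongrightarrow> p \<Longrightarrow> F p = 0"
  shows "\<exists>a\<in>K. (\<phi> \<longlongrightarrow> a) at_top"
proof -
  have lim: "\<exists>p\<in>A. \<exists>s. strict_mono s \<and> filterlim (\<lambda>k. u (s k)) at_top sequentially \<and> (\<lambda>k. \<phi> (u (s k))) \<longlonglongrightarrow> p"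
    if A: "compact A" "\<And>n. \<phi> (u n) \<in> A" "\<And>n. real n \<le> u n" for A and u :: "nat \<Rightarrow> real"
  proof -
    obtain p s where ps: "p \<in> A" "strict_mono (s :: nat \<Rightarrow> nat)" "((\<lambda>n. \<phi> (u n)) \<circ> s) \<longlonglongrightarrow> p"
      using A(1,2) unfolding compact_def by (metis (no_types, lifting))
    have "filterlim u at_top sequentially"
      by (rule filterlim_at_top_mono[OF filterlim_real_sequentially]) (use A(3) in simp)
    then have "filterlim (\<lambda>k. u (s k)) at_top sequentially"
      using filterlim_compose filterlim_subseq[OF ps(2)] by blast
    then show ?thesis using ps unfolding o_def by blast
  qed
  obtain a s where a: "a \<in> K" "strict_mono s" "(\<lambda>k. \<phi> (real (s k))) \<longlonglongrightarrow> a"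
    "filterlim (\<lambda>k. real (s k)) at_top sequentially"
    using lim[OF K(1), of real] inK by auto
  have Fa: "F a = 0" using eq a by blast
  have a\<Omega>: "a \<in> \<Omega>" using a K by blast
  obtain b where b: "b \<in> \<Omega>" "F b \<noteq> 0" using F(4) by blast
  obtain \<rho> where \<rho>: "0 < \<rho>" "\<And>z. z \<in> ball a \<rho> - {a} \<Longrightarrow> F z \<noteq> 0"
    using isolated_zeros[OF F(1-3) a\<Omega> Fa b] by metis
  have "(\<phi> \<longlongrightarrow> a) at_top"
  proof (rule ccontr)
    assume "\<not> (\<phi> \<longlongrightarrow> a) at_top"
    then obtain \<epsilon> where \<epsilon>: "0 < \<epsilon>" "\<not> eventually (\<lambda>t. dist (\<phi> t) a < \<epsilon>) at_top"
      unfolding tendsto_iff by blast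
    \<comment> \<open>The circle of radius \<open>e\<close> must be crossed on leaving the disc of
      radius \<epsilon>, and it lies in the punctured disc where \<open>F\<close> has no
      zeros.\<close>
    define e where "e = min \<epsilon> \<rho> / 2"
    have e: "0 < e" "e < \<epsilon>" "e < \<rho>" unfolding e_def using \<epsilon> \<rho> by (auto simp: min_def)
    have "\<exists>t\<ge>real n. dist (\<phi> t) a = e" for n
    proof -
      have "eventually (\<lambda>k. dist (\<phi> (real (s k))) a < e) sequentially"
        using a(3) e(1) tendstoD by blast
      moreover have "eventually (\<lambda>k. real n \<le> real (s k)) sequentially"
        using a(4) unfolding filterlim_at_top by (rule spec)
      ultimately obtain k where k: "dist (\<phi> (real (s k))) a < e" "real n \<le> real (s k)"
        using eventually_happens'[OF _ eventually_conj] by (metis (no_types, lifting) sequentially_bot)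
      define t1 where "t1 = real (s k)"
      obtain t2 where t2: "t1 \<le> t2" "\<not> dist (\<phi> t2) a < \<epsilon>"
        using \<epsilon>(2) unfolding eventually_at_top_linorder by blast
      have "continuous_on {t1..t2} (\<lambda>t. dist (\<phi> t) a)"
        by (intro continuous_intros continuous_on_subset[OF cont]) (auto simp: t1_def)
      then obtain t where "t1 \<le> t" "t \<le> t2" "dist (\<phi> t) a = e"
        using IVT'[of "\<lambda>t. dist (\<phi> t) a" t1 e t2] k t2 e unfolding t1_def by auto
      then show ?thesis using k unfolding t1_def by (intro exI[of _ t]) linarith
    qed
    then obtain u where u: "\<And>n. real n \<le> u n" "\<And>n. dist (\<phi> (u n)) a = e" by metis
    have "0 \<le> u n" for n using u(1)[of n] by linarith
    then have "\<phi> (u n) \<in> K \<inter> sphere a e" for n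
      using inK u(2) by (simp add: dist_commute)
    then obtain q s' where q: "q \<in> K \<inter> sphere a e" "filterlim (\<lambda>k. u (s' k)) at_top sequentially"
       "(\<lambda>k. \<phi> (u (s' k))) \<longlonglongrightarrow> q"
      using lim[of "K \<inter> sphere a e" u] K(1) u(1) compact_Int_closed[OF K(1) closed_sphere] by blast
    then have "F q = 0" using eq by blast
    moreover have "q \<in> ball a \<rho> - {a}" using q(1) e by auto
    ultimately show False using \<rho>(2) by blast
  qed
  then show ?thesis using a(1) by blast
qed

section \<open>Dichotomy for orbits that stay in a compact set\<close>

context holo_field
begin

lemma flow_const: "a \<in> \<Omega> \<Longrightarrow> F a = 0 \<Longrightarrow> ex_ivl F \<Omega> a = UNIV \<and> flow F \<Omega> t a = a"
proof -
  assume "a \<in> \<Omega>" "F a = 0"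
  then have "is_sol F \<Omega> a UNIV (\<lambda>_. a)" unfolding is_sol_def by auto
  then show ?thesis using sol_subset flow_eq by blast
qed

lemma bounded_orbit_dichotomy:
  assumes F: "connected \<Omega>" "\<exists>z\<in>\<Omega>. F z \<noteq> 0"
    and K: "compact K" "K \<subseteq> \<Omega>" and x: "x \<in> K" "pos_orbit F \<Omega> x \<subseteq> K"
  shows "(F x \<noteq> 0 \<and> (\<exists>T>0. T \<in> ex_ivl F \<Omega> x \<and> flow F \<Omega> T x = x)) \<or>
    (\<exists>a. equilibrium F \<Omega> a \<and> pos_limit_set F \<Omega> x = {a})"
proof -
  have x\<Omega>: "x \<in> \<Omega>" using x K by blast
  let ?\<phi> = "\<lambda>t. flow F \<Omega> t x"
  note sol = flow_sol[OF x\<Omega>]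
  note I = flow_global_pos[OF x\<Omega> K x(2)]
  have inK: "\<forall>t\<ge>0. ?\<phi> t \<in> K"
    using x(2) I unfolding pos_orbit_def by auto
  show ?thesis
  proof (cases "\<exists>p tk. p \<in> K \<and> F p \<noteq> 0 \<and> filterlim tk at_top sequentially \<and> (\<lambda>k. ?\<phi> (tk k)) \<longlonglongrightarrow> p")
    case True
    then obtain p tk where p: "p \<in> K" "F p \<noteq> 0" "filterlim tk at_top sequentially" "(\<lambda>k. ?\<phi> (tk k)) \<longlonglongrightarrow> p"
      by blast
    have "p \<in> \<Omega>" using p K by blast
    from regular_limit_point_recurrent[OF sol I K inK this p(2-4)]
    obtain T where "0 < T" "?\<phi> T = x" by blast
    \<comment> \<open>A stationary orbit has only its own point as limit, which would turn
      \<open>p\<close> into an equilibrium.\<close>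
    moreover have "F x \<noteq> 0"
    proof
      assume "F x = 0"
      then have "(\<lambda>k::nat. x) \<longlonglongrightarrow> p" using p(4) flow_const[OF x\<Omega>] by simp
      then have "x = p" by (simp only: LIMSEQ_const_iff)
      then show False using \<open>F x = 0\<close> p(2) by simp
    qed
    moreover have "T \<in> ex_ivl F \<Omega> x" using I \<open>0 < T\<close> by auto
    ultimately show ?thesis by blast
  next
    case False
    have cont: "continuous_on {0..} ?\<phi>"
    proof (rule continuous_at_imp_continuous_on, rule ballI)
      fix t :: real assume "t \<in> {0..}"
      then have "t \<in> ex_ivl F \<Omega> x" using I by blast
      then show "isCont ?\<phi> t"
        using sol has_vector_derivative_continuous unfolding is_sol_def by blast
    qed
    have "\<exists>a\<in>K. (?\<phi> \<longlongrightarrow> a) at_top"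
      by (rule no_regular_limit_point_imp_convergent[OF holo open_dom F cont K inK]) (use False in blast)+
    then obtain a where a: "a \<in> K" "(?\<phi> \<longlongrightarrow> a) at_top" by blast
    have "a \<in> \<Omega>" using a K by blast
    then have "equilibrium F \<Omega> a"
      using limit_is_equilibrium[OF sol I a(2)] unfolding equilibrium_def by blast
    moreover have "pos_limit_set F \<Omega> x = {a}"
    proof
      show "pos_limit_set F \<Omega> x \<subseteq> {a}"
      proof
        fix v assume "v \<in> pos_limit_set F \<Omega> x"
        then obtain tk where tk: "filterlim tk at_top sequentially" "(\<lambda>k. ?\<phi> (tk k)) \<longlonglongrightarrow> v"
          unfolding pos_limit_set_def by blast
        show "v \<in> {a}"
          using LIMSEQ_unique[OF tk(2) filterlim_compose[OF a(2) tk(1)]] by simp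
      qed
      have "(\<lambda>k. ?\<phi> (real k)) \<longlonglongrightarrow> a"
        using filterlim_compose[OF a(2) filterlim_real_sequentially] .
      moreover have "\<forall>k. real k \<in> ex_ivl F \<Omega> x" using I by auto
      ultimately have "a \<in> pos_limit_set F \<Omega> x"
        unfolding pos_limit_set_def using filterlim_real_sequentially
        by (intro CollectI exI[of _ real] conjI)
      then show "{a} \<subseteq> pos_limit_set F \<Omega> x" by simp
    qed
    ultimately show ?thesis by blast
  qed
qed

end

text \<open>A Riemann map followed by a disc automorphism carries \<open>D\<close> to the unit disc
  and \<open>a\<close> to 0. The second fixed point \<beta> is then a nonzero point where equality
  holds in the Schwarz lemma, so \<open>H\<close> is a rotation, and fixing \<beta> makes it
  trivial. On the whole plane squaring, with fixed points 0 and 1, is a counterexample.\<close>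

lemma holomorphic_self_map_two_fixed_points:
  assumes D: "open D" "simply_connected D" "D \<noteq> UNIV"
    and g: "g holomorphic_on D" "g ` D \<subseteq> D"
    and ab: "a \<in> D" "b \<in> D" "a \<noteq> b" "g a = a" "g b = b" and z: "z \<in> D"
  shows "g z = z"
proof -
  have "D \<noteq> {}" using ab by blast
  then obtain f k where f: "f holomorphic_on D" and k: "k holomorphic_on ball 0 1"
    and fk: "\<forall>z\<in>D. f z \<in> ball 0 1 \<and> k (f z) = z" "\<forall>z\<in>ball 0 1. k z \<in> D \<and> f (k z) = z"
    using Riemann_mapping_theorem[of D] D by blast
  have "f a \<in> ball 0 1" using fk ab by blast
  then obtain m m' where m: "m (f a) = 0" "m holomorphic_on ball 0 1" "m ` ball 0 1 \<subseteq> ball 0 1"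
    and m': "m' holomorphic_on ball 0 1" "m' ` ball 0 1 \<subseteq> ball 0 1"
    and mm: "\<And>z. z \<in> ball 0 1 \<Longrightarrow> m (m' z) = z" "\<And>z. z \<in> ball 0 1 \<Longrightarrow> m' (m z) = z"
    using ball_biholomorphism_exists by metis
  define u where "u = m \<circ> f"
  define v where "v = k \<circ> m'"
  have mb: "m z \<in> ball 0 1" "m' z \<in> ball 0 1" if "z \<in> ball 0 1" for z
    using m(3) m'(2) that by blast+
  have "u holomorphic_on D"
    unfolding u_def by (rule holomorphic_on_compose_gen[OF f m(2)]) (use fk in blast)
  moreover have "u z \<in> ball 0 1" if "z \<in> D" for z
    unfolding u_def o_def by (rule mb) (use fk that in blast)
  ultimately have u: "u holomorphic_on D" "\<And>z. z \<in> D \<Longrightarrow> u z \<in> ball 0 1" by blast+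
  have "v holomorphic_on ball 0 1"
    unfolding v_def by (rule holomorphic_on_compose_gen[OF m'(1) k m'(2)])
  moreover have "v z \<in> D" if "z \<in> ball 0 1" for z
    unfolding v_def o_def using fk mb(2)[OF that] by blast
  ultimately have v: "v holomorphic_on ball 0 1" "\<And>z. z \<in> ball 0 1 \<Longrightarrow> v z \<in> D" by blast+
  have vu: "v (u z) = z" if "z \<in> D" for z unfolding u_def v_def using mm fk that by auto
  define H where "H = u \<circ> (g \<circ> v)"
  have H: "H holomorphic_on ball 0 1" "\<And>z. norm z < 1 \<Longrightarrow> norm (H z) < 1"
  proof -
    have "(g \<circ> v) holomorphic_on ball 0 1"
      by (rule holomorphic_on_compose_gen[OF v(1) g(1)]) (use v in auto)
    then show "H holomorphic_on ball 0 1" unfolding H_def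
      by (rule holomorphic_on_compose_gen[OF _ u(1)]) (use v g in auto)
    show "norm (H z) < 1" if "norm z < 1" for z
      using u(2)[of "g (v z)"] v(2)[of z] g(2) that unfolding H_def by auto
  qed
  have H0: "H 0 = 0" unfolding H_def using vu[OF ab(1)] ab(4) m(1) u_def by auto
  define \<beta> where "\<beta> = u b"
  have "u a = 0" unfolding u_def using m(1) by simp
  then have \<beta>: "norm \<beta> < 1" "\<beta> \<noteq> 0" "H \<beta> = \<beta>"
    unfolding \<beta>_def H_def using u(2)[OF ab(2)] vu ab by (auto, metis)
  obtain \<alpha> where \<alpha>: "\<forall>z. norm z < 1 \<longrightarrow> H z = \<alpha> * z"
  proof -
    have "\<exists>z. norm z < 1 \<and> z \<noteq> 0 \<and> norm (H z) = norm z" using \<beta> by metis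
    then show thesis using Schwarz_Lemma(3)[OF H(1) H0 H(2) \<beta>(1)] that by blast
  qed
  then have "\<alpha> = 1" using \<beta> by (metis mult_cancel_right1)
  then have "H (u z) = u z" using \<alpha> u(2)[OF z] by simp
  then have "u (g z) = u z" unfolding H_def using vu[OF z] by simp
  then show ?thesis using vu z g(2) by (metis image_subset_iff)
qed

context holo_field
begin

subsection \<open>Time reversal\<close>

lemma reverse_sol:
  assumes "is_sol F \<Omega> x J \<phi>"
  shows "is_sol (\<lambda>z. - F z) \<Omega> x (uminus ` J) (\<lambda>t. \<phi> (- t))"
proof -
  have "is_interval (uminus ` J)" "open (uminus ` J)"
    using assms open_negations unfolding is_sol_def by auto
  moreover have "((\<lambda>t. \<phi> (- t)) has_vector_derivative - F (\<phi> (- t))) (at t)" if "- t \<in> J" for t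
  proof -
    have "(uminus has_vector_derivative (- 1 :: real)) (at t)" by (auto intro!: derivative_eq_intros)
    from vector_diff_chain_at[OF this, of \<phi> "F (\<phi> (- t))"] show ?thesis
      using assms that unfolding is_sol_def o_def by auto
  qed
  moreover have "\<phi> (- t) \<in> \<Omega>" if "- t \<in> J" for t using assms that unfolding is_sol_def by blast
  moreover have "- t \<in> J" if "t \<in> uminus ` J" for t using that by auto
  moreover have "0 \<in> uminus ` J" "\<phi> (- 0) = x" using assms unfolding is_sol_def by (force, simp)
  ultimately show ?thesis unfolding is_sol_def by blast
qed

lemma reverse_holo_field: "holo_field (\<lambda>z. - F z) \<Omega>"
  using holo_field_mult[of "-1"] by simp

lemma reverse_ex_ivl: "ex_ivl (\<lambda>z. - F z) \<Omega> x = uminus ` ex_ivl F \<Omega> x"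
proof -
  interpret R: holo_field "\<lambda>z. - F z" \<Omega> by (rule reverse_holo_field)
  show ?thesis
  proof (intro equalityI subsetI)
    fix t assume "t \<in> ex_ivl (\<lambda>z. - F z) \<Omega> x"
    then obtain J \<phi> where J: "is_sol (\<lambda>z. - F z) \<Omega> x J \<phi>" "t \<in> J" unfolding ex_ivl_def by blast
    have "is_sol F \<Omega> x (uminus ` J) (\<lambda>t. \<phi> (- t))" using R.reverse_sol[OF J(1)] by simp
    from sol_subset[OF this] have "- t \<in> ex_ivl F \<Omega> x" using J(2) by blast
    then show "t \<in> uminus ` ex_ivl F \<Omega> x" by (rule rev_image_eqI) simp
  next
    fix t assume "t \<in> uminus ` ex_ivl F \<Omega> x"
    then obtain s where s: "s \<in> ex_ivl F \<Omega> x" "t = - s" by blast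
    then obtain J \<phi> where J: "is_sol F \<Omega> x J \<phi>" "s \<in> J" unfolding ex_ivl_def by blast
    from R.sol_subset[OF reverse_sol[OF J(1)]] show "t \<in> ex_ivl (\<lambda>z. - F z) \<Omega> x"
      using J(2) s(2) by blast
  qed
qed

lemma reverse_flow:
  assumes "x \<in> \<Omega>" "t \<in> ex_ivl F \<Omega> x"
  shows "flow (\<lambda>z. - F z) \<Omega> (- t) x = flow F \<Omega> t x"
proof -
  interpret R: holo_field "\<lambda>z. - F z" \<Omega> by (rule reverse_holo_field)
  have "flow (\<lambda>z. - F z) \<Omega> (- t) x = flow F \<Omega> (- (- t)) x"
    by (rule R.flow_eq[OF reverse_sol[OF flow_sol[OF assms(1)]]]) (use assms in simp)
  then show ?thesis by simp
qed

lemma reverse_pos_orbit: "x \<in> \<Omega> \<Longrightarrow> pos_orbit (\<lambda>z. - F z) \<Omega> x = neg_orbit F \<Omega> x"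
proof -
  assume x: "x \<in> \<Omega>"
  have "uminus ` ex_ivl F \<Omega> x \<inter> {0..} = uminus ` (ex_ivl F \<Omega> x \<inter> {..0})" by auto
  then show ?thesis
    unfolding pos_orbit_def neg_orbit_def reverse_ex_ivl
    by (simp add: image_image reverse_flow[OF x] cong: image_cong_simp)
qed

lemma reverse_pos_limit_set:
  assumes x: "x \<in> \<Omega>"
  shows "pos_limit_set (\<lambda>z. - F z) \<Omega> x = neg_limit_set F \<Omega> x"
proof (intro equalityI subsetI)
  fix v assume "v \<in> pos_limit_set (\<lambda>z. - F z) \<Omega> x"
  then obtain tk where tk: "\<forall>k. tk k \<in> uminus ` ex_ivl F \<Omega> x" "filterlim tk at_top sequentially"
    "(\<lambda>k. flow (\<lambda>z. - F z) \<Omega> (tk k) x) \<longlonglongrightarrow> v"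
    unfolding pos_limit_set_def reverse_ex_ivl by blast
  have I: "- tk k \<in> ex_ivl F \<Omega> x" for k using tk(1)[rule_format, of k] by auto
  have "(\<lambda>k. flow F \<Omega> (- tk k) x) \<longlonglongrightarrow> v"
    using tk(3) reverse_flow[OF x I] by simp
  moreover have "filterlim (\<lambda>k. - tk k) at_bot sequentially"
    using tk(2) by (simp add: filterlim_uminus_at_bot)
  ultimately show "v \<in> neg_limit_set F \<Omega> x"
    unfolding neg_limit_set_def using I by (intro CollectI exI[of _ "\<lambda>k. - tk k"]) blast
next
  fix v assume "v \<in> neg_limit_set F \<Omega> x"
  then obtain tk where tk: "\<forall>k. tk k \<in> ex_ivl F \<Omega> x" "filterlim tk at_bot sequentially"
    "(\<lambda>k. flow F \<Omega> (tk k) x) \<longlonglongrightarrow> v"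
    unfolding neg_limit_set_def by blast
  have "(\<lambda>k. flow (\<lambda>z. - F z) \<Omega> (- tk k) x) \<longlonglongrightarrow> v"
    using tk(3) reverse_flow[OF x] tk(1) by simp
  moreover have "filterlim (\<lambda>k. - tk k) at_top sequentially"
    using tk(2) by (simp add: filterlim_uminus_at_top)
  moreover have "\<forall>k. - tk k \<in> ex_ivl (\<lambda>z. - F z) \<Omega> x"
    using tk(1) unfolding reverse_ex_ivl by blast
  ultimately show "v \<in> pos_limit_set (\<lambda>z. - F z) \<Omega> x"
    unfolding pos_limit_set_def by (intro CollectI exI[of _ "\<lambda>k. - tk k"]) blast
qed

lemma flow_global:
  assumes x: "x \<in> \<Omega>" and K: "compact K" "K \<subseteq> \<Omega>" and sub: "orbit F \<Omega> x \<subseteq> K"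
  shows "ex_ivl F \<Omega> x = UNIV"
proof -
  interpret R: holo_field "\<lambda>z. - F z" \<Omega> by (rule reverse_holo_field)
  have "{0..} \<subseteq> ex_ivl F \<Omega> x"
    by (rule flow_global_pos[OF x K]) (use sub in \<open>auto simp: orbit_def pos_orbit_def\<close>)
  moreover have R: "{0..} \<subseteq> uminus ` ex_ivl F \<Omega> x"
    unfolding reverse_ex_ivl[symmetric]
    by (rule R.flow_global_pos[OF x K])
       (use sub in \<open>unfold reverse_pos_orbit[OF x], auto simp: orbit_def neg_orbit_def\<close>)
  have "t \<in> ex_ivl F \<Omega> x" if "t \<le> 0" for t
  proof -
    have "- t \<in> uminus ` ex_ivl F \<Omega> x" using R that by (simp add: subset_iff)
    then show ?thesis by auto
  qed
  ultimately show ?thesis by (metis UNIV_eq_I atLeast_iff linear subsetD)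
qed

subsection \<open>Periodic orbits\<close>

text \<open>The component of the motion in the direction \<open>F x\<close> has derivative
  \<open>(norm (F x))\<^sup>2 > 0\<close> at time 0, so it increases at once. This excludes
  arbitrarily short return times.\<close>

lemma flow_no_return_near:
  assumes x: "x \<in> \<Omega>" "F x \<noteq> 0"
  shows "\<exists>e>0. \<forall>t. 0 < t \<and> t < e \<longrightarrow> flow F \<Omega> t x \<noteq> x"
proof -
  have "((\<lambda>t. flow F \<Omega> t x) has_vector_derivative F x) (at 0)"
    using flow_sol[OF x(1)] unfolding is_sol_def by metis
  then have "((\<lambda>t. Re (flow F \<Omega> t x * cnj (F x))) has_vector_derivative Re (F x * cnj (F x))) (at 0)"
    by (intro bounded_linear.has_vector_derivative[OF bounded_linear_Re]
          bounded_linear.has_vector_derivative[OF bounded_linear_mult_left])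
  then have "((\<lambda>t. Re (flow F \<Omega> t x * cnj (F x))) has_real_derivative (norm (F x))\<^sup>2) (at 0)"
    unfolding has_real_derivative_iff_has_vector_derivative cmod_power2
    by (simp add: power2_eq_square)
  from DERIV_pos_inc_right[OF this] x
  obtain e where e: "e > 0"
    "\<forall>h>0. h < e \<longrightarrow> Re (flow F \<Omega> 0 x * cnj (F x)) < Re (flow F \<Omega> (0 + h) x * cnj (F x))" by auto
  show ?thesis
    using e flow_0(2)[OF x(1)] by (intro exI[of _ e]) force
qed

lemma flow_add_global:
  "x \<in> \<Omega> \<Longrightarrow> ex_ivl F \<Omega> x = UNIV \<Longrightarrow> flow F \<Omega> t (flow F \<Omega> s x) = flow F \<Omega> (s + t) x"
  using flow_add(2) by simp

text \<open>By the group law the interval of existence is invariant under translation by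
  \<open>T\<close>; it contains all multiples of \<open>T\<close> and everything between
  them.\<close>

lemma return_imp_global:
  assumes x: "x \<in> \<Omega>" and T: "0 < T" "T \<in> ex_ivl F \<Omega> x" "flow F \<Omega> T x = x"
  shows "ex_ivl F \<Omega> x = UNIV"
proof -
  have sh: "T + t \<in> ex_ivl F \<Omega> x \<longleftrightarrow> t \<in> ex_ivl F \<Omega> x" for t
    using flow_add(1)[OF x T(2), of t] T(3) by simp
  have n: "of_nat n * T \<in> ex_ivl F \<Omega> x \<and> - (of_nat n * T) \<in> ex_ivl F \<Omega> x" for n
  proof (induction n)
    case (Suc n)
    have "of_nat (Suc n) * T = T + of_nat n * T" "- (of_nat n * T) = T + - (of_nat (Suc n) * T)"
      by (simp_all add: algebra_simps)
    then show ?case using Suc sh by metis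
  qed (use flow_0 x in auto)
  have "t \<in> ex_ivl F \<Omega> x" for t
  proof -
    obtain n where "\<bar>t\<bar> < of_nat n * T" using T(1) reals_Archimedean3 by blast
    then show ?thesis using ex_ivl_between[OF x, of "- (of_nat n * T)" "of_nat n * T" t] n by auto
  qed
  then show ?thesis by blast
qed

lemma flow_periodic:
  assumes x: "x \<in> \<Omega>" "ex_ivl F \<Omega> x = UNIV" and T: "flow F \<Omega> T x = x"
  shows "flow F \<Omega> (t + of_int n * T) x = flow F \<Omega> t x"
proof -
  have nat: "flow F \<Omega> (t + of_nat n * T) x = flow F \<Omega> t x" for t n
  proof (induction n)
    case (Suc n)
    have "flow F \<Omega> (T + (t + of_nat n * T)) x = flow F \<Omega> (t + of_nat n * T) x"
      using flow_add_global[OF x, of "t + of_nat n * T" T] T by simp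
    moreover have "t + of_nat (Suc n) * T = T + (t + of_nat n * T)" by (simp add: algebra_simps)
    ultimately show ?case using Suc by (simp only:)
  qed simp
  show ?thesis
  proof (cases "0 \<le> n")
    case True then show ?thesis using nat[of t "nat n"] by simp
  next
    case False then show ?thesis using nat[of "t + of_int n * T" "nat (- n)"] by simp
  qed
qed

lemma orbit_eq_period_image:
  assumes x: "x \<in> \<Omega>" "ex_ivl F \<Omega> x = UNIV" and T: "0 < T" "flow F \<Omega> T x = x"
  shows "orbit F \<Omega> x = (\<lambda>t. flow F \<Omega> t x) ` {0..T}"
proof -
  have "flow F \<Omega> t x \<in> (\<lambda>t. flow F \<Omega> t x) ` {0..T}" for t
  proof -
    define n where "n = \<lfloor>t / T\<rfloor>"
    have "of_int n \<le> t / T" "t / T < of_int n + 1" unfolding n_def by linarith+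
    then have "t + of_int (- n) * T \<in> {0..T}" using T(1) by (simp add: field_simps)
    then show ?thesis using flow_periodic[OF x T(2), of t "- n"] by (metis imageI)
  qed
  then show ?thesis unfolding orbit_def x(2) by blast
qed

lemma continuous_flow: "x \<in> \<Omega> \<Longrightarrow> ex_ivl F \<Omega> x = UNIV \<Longrightarrow> continuous_on A (\<lambda>t. flow F \<Omega> t x)"
  using flow_sol[of x] unfolding is_sol_def
  by (auto intro!: continuous_at_imp_continuous_on intro: has_vector_derivative_continuous)

text \<open>The given \<open>T\<close> may run round the orbit several times, so a simple
  parametrisation needs the least return time \<open>T0\<close>. It exists because the return times
  in \<open>{e..T}\<close> form a compact set and none is shorter than \<open>e\<close>.\<close>

lemma return_imp_closed_orbit:
  assumes x: "x \<in> \<Omega>" "F x \<noteq> 0" and I: "ex_ivl F \<Omega> x = UNIV" and T: "0 < T" "flow F \<Omega> T x = x"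
  shows "closed_orbit F \<Omega> x"
proof -
  let ?\<phi> = "\<lambda>t. flow F \<Omega> t x"
  obtain e where e: "0 < e" "\<forall>t. 0 < t \<and> t < e \<longrightarrow> ?\<phi> t \<noteq> x"
    using flow_no_return_near[OF x] by blast
  let ?S = "{t \<in> {e..T}. ?\<phi> t = x}"
  have "closed ?S" by (intro continuous_closed_preimage_constant continuous_flow x I closed_atLeastAtMost)
  moreover have "bounded ?S" by (rule bounded_subset[OF bounded_closed_interval]) auto
  ultimately have "compact ?S" by (simp add: compact_eq_bounded_closed)
  moreover have "T \<in> ?S" using T e by force
  ultimately obtain T0 where T0: "T0 \<in> ?S" "\<forall>t\<in>?S. T0 \<le> t"
    using compact_attains_inf by blast
  have T0': "0 < T0" "?\<phi> T0 = x" "T0 \<le> T" using T0 e by auto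
  have noret: "?\<phi> t \<noteq> x" if "0 < t" "t < T0" for t
  proof
    assume "?\<phi> t = x"
    then have "t \<in> ?S" using that e(2) T0'(3) by (force simp: not_less)
    then show False using T0(2) that by force
  qed
  have inj: "\<not> (0 \<le> s \<and> s < t \<and> t < T0 + s \<and> ?\<phi> s = ?\<phi> t)" for s t
  proof
    assume *: "0 \<le> s \<and> s < t \<and> t < T0 + s \<and> ?\<phi> s = ?\<phi> t"
    have "?\<phi> (t - s) = ?\<phi> (s - s)"
      using flow_add_global[OF x(1) I, of "- s" s] flow_add_global[OF x(1) I, of "- s" t] * by simp
    then have "?\<phi> (t - s) = x" using flow_0 x by simp
    then show False using noret[of "t - s"] * by auto
  qed
  define g where "g = (\<lambda>u. ?\<phi> (T0 * u))"
  have "path g" unfolding path_def g_def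
    by (rule continuous_on_compose2[OF continuous_flow[OF x(1) I, of UNIV]]) (auto intro!: continuous_intros)
  moreover have "loop_free g"
    unfolding loop_free_def
  proof (intro ballI impI)
    have *: "u = 0 \<and> v = 1" if "0 \<le> u" "u < v" "v \<le> 1" "g u = g v" for u v
    proof -
      have "T0 * u < T0 * v" "0 \<le> T0 * u" "T0 * v \<le> T0" using that T0' by auto
      then have "\<not> T0 * v < T0 + T0 * u" using inj[of "T0 * u" "T0 * v"] that(4) unfolding g_def by blast
      then have "T0 * (1 + u) \<le> T0 * v" by (simp add: algebra_simps)
      then have "1 + u \<le> v" using T0' by simp
      then show ?thesis using that by linarith
    qed
    fix u v :: real assume "u \<in> {0..1}" "v \<in> {0..1}" "g u = g v"
    then show "u = v \<or> u = 0 \<and> v = 1 \<or> u = 1 \<and> v = 0"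
      using *[of u v] *[of v u] by (cases u v rule: linorder_cases) auto
  qed
  moreover have "pathfinish g = pathstart g"
    unfolding pathfinish_def pathstart_def g_def using T0' flow_0 x by simp
  moreover have "path_image g = orbit F \<Omega> x"
  proof -
    have "(\<lambda>u. T0 * u) ` {0..1} = {0..T0}"
      using image_mult_atLeastAtMost[of T0 0 1] T0' by simp
    then have "path_image g = ?\<phi> ` {0..T0}"
      using image_image[of ?\<phi> "\<lambda>u. T0 * u" "{0..1}"] unfolding path_image_def g_def by simp
    then show ?thesis using orbit_eq_period_image[OF x(1) I T0'(1,2)] by simp
  qed
  ultimately show ?thesis unfolding closed_orbit_def simple_path_def by blast
qed

lemma return_imp_periodic_orbit:
  assumes "x \<in> \<Omega>" "F x \<noteq> 0" "0 < T" "T \<in> ex_ivl F \<Omega> x" "flow F \<Omega> T x = x"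
  shows "periodic_orbit F \<Omega> x"
  using assms return_imp_closed_orbit return_imp_global unfolding periodic_orbit_def by blast

lemma flow_not_equilibrium:
  assumes x: "x \<in> \<Omega>" "F x \<noteq> 0" "ex_ivl F \<Omega> x = UNIV"
  shows "F (flow F \<Omega> t x) \<noteq> 0"
proof
  assume *: "F (flow F \<Omega> t x) = 0"
  have "flow F \<Omega> (- t) (flow F \<Omega> t x) = flow F \<Omega> t x"
    using flow_const flow_in_dom x * by simp
  then have "flow F \<Omega> t x = x" using flow_add_global[OF x(1,3), of "- t" t] flow_0 x by simp
  then show False using * x by simp
qed

text \<open>Orbits that meet coincide. Only the solution from \<open>x\<close> is taken to be
  global, since for a point \<open>y\<close> inside a periodic orbit globality is a consequence of
  this disjointness.\<close>

lemma mem_orbit_of_flow: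
  assumes x: "x \<in> \<Omega>" "ex_ivl F \<Omega> x = UNIV" and y: "y \<in> \<Omega>" "t \<in> ex_ivl F \<Omega> y"
    and t: "flow F \<Omega> t y \<in> orbit F \<Omega> x"
  shows "y \<in> orbit F \<Omega> x"
proof -
  obtain s where s: "flow F \<Omega> t y = flow F \<Omega> s x" using t unfolding orbit_def by blast
  have "y = flow F \<Omega> (- t) (flow F \<Omega> t y)"
    using flow_add(2)[OF y, of "- t"] flow_0[OF y(1)] by simp
  then have "y = flow F \<Omega> (s - t) x"
    using flow_add_global[OF x, of "- t" s] s by simp
  then show ?thesis unfolding orbit_def x(2) by blast
qed

lemma reverse_periodic_orbit:
  assumes "periodic_orbit (\<lambda>z. - F z) \<Omega> x"
  shows "periodic_orbit F \<Omega> x"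
proof -
  interpret R: holo_field "\<lambda>z. - F z" \<Omega> by (rule reverse_holo_field)
  obtain T where T: "0 < T" "flow (\<lambda>z. - F z) \<Omega> T x = x" and x: "x \<in> \<Omega>" "F x \<noteq> 0"
    and co: "closed_orbit (\<lambda>z. - F z) \<Omega> x"
    using assms unfolding periodic_orbit_def by auto
  have "ex_ivl (\<lambda>z. - F z) \<Omega> x = UNIV"
    using R.return_imp_global assms unfolding periodic_orbit_def by blast
  then have I: "ex_ivl F \<Omega> x = UNIV"
    unfolding reverse_ex_ivl by (metis UNIV_eq_I UNIV_I image_iff minus_minus)
  have "flow F \<Omega> (- T) x = x" using reverse_flow[OF x(1), of "- T"] I T(2) by simp
  then have "flow F \<Omega> T x = x" using flow_periodic[OF x(1) I, of "- T" 0 "- 1"] flow_0[OF x(1)] by simp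
  then show ?thesis using return_imp_periodic_orbit[OF x T(1)] I by simp
qed

lemma periodic_or_convergent:
  assumes "connected \<Omega>" "simply_connected \<Omega>" "\<exists>z\<in>\<Omega>. F z \<noteq> 0"
    and "compact K" "K \<subseteq> \<Omega>" "x \<in> K" "pos_orbit F \<Omega> x \<subseteq> K"
  shows "periodic_orbit F \<Omega> x \<or> (\<exists>a. equilibrium F \<Omega> a \<and> pos_limit_set F \<Omega> x = {a})"
  using bounded_orbit_dichotomy[OF assms(1,3-7)] return_imp_periodic_orbit[of x] assms(5,6) by blast

end

subsection \<open>The interior of a periodic orbit\<close>

text \<open>The base point of the orbit is a parameter, so that the facts proved here can be applied
  again to the smaller periodic orbits found inside.\<close>

locale periodic_field = holo_field +
  fixes x :: complex
  assumes conn: "connected \<Omega>" and sconn: "simply_connected \<Omega>" and per: "periodic_orbit F \<Omega> x"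
begin

abbreviation "\<Gamma> \<equiv> orbit F \<Omega> x"
abbreviation "D \<equiv> inside \<Gamma>"

lemma x_dom: "x \<in> \<Omega>" and x_regular: "F x \<noteq> 0" and x_global: "ex_ivl F \<Omega> x = UNIV"
  using per return_imp_global unfolding periodic_orbit_def by blast+

lemma period: obtains T where "0 < T" "flow F \<Omega> T x = x"
  using per unfolding periodic_orbit_def by blast

lemma orbit_dom: "\<Gamma> \<subseteq> \<Omega>"
  using flow_in_dom[OF x_dom] unfolding orbit_def by blast

text \<open>A simply connected domain has no holes that the orbit could surround.\<close>

lemma inside_dom: "D \<subseteq> \<Omega>"
  by (rule subset_simply_connected_imp_inside_subset[OF sconn open_dom orbit_dom])

lemma inside_topology:
  shows "open D" "connected D" "simply_connected D" "bounded D" "D \<noteq> {}" "frontier D = \<Gamma>"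
    "compact \<Gamma>" "open (outside \<Gamma>)"
proof -
  obtain g where g: "simple_path g" "pathfinish g = pathstart g" "path_image g = \<Gamma>"
    using per unfolding periodic_orbit_def closed_orbit_def by blast
  note J = Jordan_inside_outside[OF g(1,2), unfolded g(3)]
  show "open D" "connected D" "bounded D" "D \<noteq> {}" "frontier D = \<Gamma>" "open (outside \<Gamma>)"
    using J by blast+
  show "simply_connected D" using simply_connected_inside_simple_path[OF g(1)] g(3) by simp
  show "compact \<Gamma>" using compact_simple_path_image[OF g(1)] g(3) by simp
qed

lemma compact_hull: "compact (D \<union> \<Gamma>)" "D \<union> \<Gamma> \<subseteq> \<Omega>"
proof -
  have "closure D = D \<union> \<Gamma>" using closure_Un_frontier[of D] inside_topology(6) by simp
  then show "compact (D \<union> \<Gamma>)" using inside_topology(4) compact_closure by metis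
qed (use orbit_dom inside_dom in blast)

lemma finite_zeros: "finite {z \<in> D \<union> \<Gamma>. F z = 0}"
proof (cases "F constant_on \<Omega>")
  \<comment> \<open>A constant field has the nonzero value \<open>F x\<close> throughout, hence no
    zeros.\<close>
  case True
  then have "F z = F x" if "z \<in> \<Omega>" for z using that x_dom unfolding constant_on_def by metis
  then have "{z \<in> D \<union> \<Gamma>. F z = 0} = {}" using x_regular compact_hull(2) by auto
  then show ?thesis by (metis finite.emptyI)
next
  case False
  then show ?thesis
    by (rule holomorphic_compact_finite_zeros[OF holo open_dom conn compact_hull])
qed

text \<open>The orbit is connected and disjoint from \<Gamma>, so it cannot pass from the inside to
  the outside.\<close>

lemma orbit_in_inside:
  assumes y: "y \<in> D"
  shows "orbit F \<Omega> y \<subseteq> D"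
proof -
  have y\<Omega>: "y \<in> \<Omega>" using y inside_dom by blast
  have disj: "orbit F \<Omega> y \<inter> \<Gamma> = {}"
  proof (rule ccontr)
    assume "orbit F \<Omega> y \<inter> \<Gamma> \<noteq> {}"
    then obtain t where "t \<in> ex_ivl F \<Omega> y" "flow F \<Omega> t y \<in> \<Gamma>" unfolding orbit_def by blast
    from mem_orbit_of_flow[OF x_dom x_global y\<Omega> this] show False
      using y inside_no_overlap by blast
  qed
  have "is_interval (ex_ivl F \<Omega> y)" using flow_sol[OF y\<Omega>] unfolding is_sol_def by blast
  then have "connected (ex_ivl F \<Omega> y)" by (simp add: is_interval_connected_1)
  moreover have "continuous_on (ex_ivl F \<Omega> y) (\<lambda>t. flow F \<Omega> t y)"
    using flow_sol[OF y\<Omega>] has_vector_derivative_continuous unfolding is_sol_def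
    by (blast intro: continuous_at_imp_continuous_on)
  ultimately have co: "connected (orbit F \<Omega> y)"
    unfolding orbit_def by (rule connected_continuous_image[rotated])
  have "y \<in> orbit F \<Omega> y" using flow_0[OF y\<Omega>] unfolding orbit_def by force
  then have ne: "D \<inter> orbit F \<Omega> y \<noteq> {}" using y by blast
  have cover: "orbit F \<Omega> y \<subseteq> D \<union> outside \<Gamma>" using disj inside_Un_outside by blast
  have no: "D \<inter> outside \<Gamma> = {}" by (simp add: inside_Int_outside)
  have "outside \<Gamma> \<inter> orbit F \<Omega> y = {}"
  proof (rule ccontr)
    assume "outside \<Gamma> \<inter> orbit F \<Omega> y \<noteq> {}"
    then show False
      using connectedD[OF co inside_topology(1,8)] no cover ne by blast
  qed
  then show ?thesis using cover by blast
qed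

lemma inside_global: "y \<in> D \<Longrightarrow> ex_ivl F \<Omega> y = UNIV"
  using flow_global[OF _ compact_hull, of y] orbit_in_inside inside_dom by blast

lemma flow_in_inside: "y \<in> D \<Longrightarrow> flow F \<Omega> t y \<in> D"
  using orbit_in_inside inside_global unfolding orbit_def by blast

section \<open>The time-\<open>t\<close> map on the interior\<close>

lemma strip_flow:
  assumes "csol (half_strip r) \<psi>" "s \<in> half_strip r" "0 \<le> t"
  shows "t \<in> ex_ivl F \<Omega> (\<psi> s)" "flow F \<Omega> t (\<psi> s) = \<psi> (s + of_real t)"
proof -
  note sol = csol_sol[OF open_half_strip convex_half_strip assms(1,2)]
  have t: "t \<in> {l. s + of_real l \<in> half_strip r}" using assms(2,3) unfolding half_strip_def by simp
  show "t \<in> ex_ivl F \<Omega> (\<psi> s)" using sol_subset[OF sol] t by blast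
  show "flow F \<Omega> t (\<psi> s) = \<psi> (s + of_real t)" by (rule flow_eq[OF sol t])
qed

text \<open>Near a regular point the initial value is a holomorphic coordinate for the complex time,
  and in complex time the flow is a translation.\<close>

lemma flow_differentiable:
  assumes y: "y \<in> D" "F y \<noteq> 0" and t: "0 \<le> t"
  shows "(\<lambda>z. flow F \<Omega> t z) field_differentiable (at y)"
proof -
  \<comment> \<open>Starting one time unit earlier places \<open>y\<close> at
    \<open>\<psi> 1\<close>, an interior point of the strip, where \<psi> is locally
    invertible.\<close>
  let ?w = "flow F \<Omega> (- 1) y"
  have y\<Omega>: "y \<in> \<Omega>" using y inside_dom by blast
  have w: "?w \<in> D" "?w \<in> \<Omega>" using flow_in_inside[OF y(1)] inside_dom by blast+
  have sol: "is_sol F \<Omega> ?w UNIV (\<lambda>t. flow F \<Omega> t ?w)"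
    using flow_sol[OF w(2)] inside_global[OF w(1)] by simp
  have "\<forall>t\<ge>0. flow F \<Omega> t ?w \<in> D \<union> \<Gamma>" using flow_in_inside[OF w(1)] by blast
  from real_sol_to_strip[OF sol _ compact_hull this]
  obtain r \<psi> where r: "0 < r" and \<psi>: "csol (half_strip r) \<psi>"
    and \<psi>1: "\<forall>t>0. \<psi> (of_real t) = flow F \<Omega> t ?w" by blast
  have one: "1 \<in> half_strip r" using r unfolding half_strip_def by simp
  have "\<psi> 1 = y"
    using \<psi>1[rule_format, of 1] flow_add_global[OF y\<Omega> inside_global[OF y(1)], of 1 "- 1"] flow_0[OF y\<Omega>]
    by simp
  then have "deriv \<psi> 1 \<noteq> 0"
    using \<psi> one y(2) DERIV_imp_deriv unfolding csol_def by metis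
  from has_complex_derivative_locally_invertible[OF csol_holomorphic[OF \<psi>] one open_half_strip this]
  obtain e where e: "e > 0" "ball 1 e \<subseteq> half_strip r" "open (\<psi> ` ball 1 e)" "inj_on \<psi> (ball 1 e)" by blast
  have hol: "\<psi> holomorphic_on ball 1 e"
    using csol_holomorphic[OF \<psi>] e(2) holomorphic_on_subset by blast
  obtain g where g: "g holomorphic_on (\<psi> ` ball 1 e)" "\<And>z. z \<in> ball 1 e \<Longrightarrow> g (\<psi> z) = z"
    using holomorphic_has_inverse[OF hol open_ball e(4)] by metis
  have "(\<lambda>z. g z + of_real t) ` (\<psi> ` ball 1 e) \<subseteq> half_strip r"
    using g(2) e(2) t unfolding half_strip_def by auto
  then have "(\<psi> \<circ> (\<lambda>z. g z + of_real t)) holomorphic_on \<psi> ` ball 1 e"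
    by (intro holomorphic_on_compose_gen[OF _ csol_holomorphic[OF \<psi>]] holomorphic_intros g)
  moreover have "(\<psi> \<circ> (\<lambda>z. g z + of_real t)) z = flow F \<Omega> t z" if "z \<in> \<psi> ` ball 1 e" for z
    using that g(2) strip_flow(2)[OF \<psi> _ t] e(2) by auto
  ultimately have "(\<lambda>z. flow F \<Omega> t z) holomorphic_on \<psi> ` ball 1 e"
    by (rule holomorphic_transform)
  moreover have "y \<in> \<psi> ` ball 1 e" using \<open>\<psi> 1 = y\<close> e(1) by (metis centre_in_ball imageI)
  ultimately show ?thesis using e(3) holomorphic_on_imp_differentiable_at by blast
qed

text \<open>Deleting finitely many points does not disconnect a connected open plane set, so
  analytic continuation is available on the regular part before anything is known at the
  zeros.\<close>

lemma regular_inside: "open (D - {z \<in> D \<union> \<Gamma>. F z = 0})" "connected (D - {z \<in> D \<union> \<Gamma>. F z = 0})"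
  "(\<lambda>z. flow F \<Omega> t z) holomorphic_on D - {z \<in> D \<union> \<Gamma>. F z = 0}" if "0 \<le> t"
proof -
  show "open (D - {z \<in> D \<union> \<Gamma>. F z = 0})"
    using finite_zeros inside_topology(1) finite_imp_closed open_Diff by blast
  show "connected (D - {z \<in> D \<union> \<Gamma>. F z = 0})"
    using finite_zeros inside_topology(1,2)
    by (intro connected_open_diff_countable) (auto intro: countable_finite)
  show "(\<lambda>z. flow F \<Omega> t z) holomorphic_on D - {z \<in> D \<union> \<Gamma>. F z = 0}"
    unfolding holomorphic_on_def
  proof
    fix y assume "y \<in> D - {z \<in> D \<union> \<Gamma>. F z = 0}"
    then have "y \<in> D" "F y \<noteq> 0" by blast+
    from flow_differentiable[OF this that]
    show "(\<lambda>z. flow F \<Omega> t z) field_differentiable at y within D - {z \<in> D \<union> \<Gamma>. F z = 0}"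
      by (rule field_differentiable_at_within)
  qed
qed

text \<open>The extension \<psi> of the periodic solution has period \<open>T\<close> on its whole
  strip, so the time-\<open>T\<close> map fixes an open neighbourhood of an orbit point. As \<Gamma>
  is the frontier of the interior, this neighbourhood meets the interior, and analytic continuation
  on the regular part does the rest.\<close>

lemma inside_periodic:
  assumes T: "0 < T" "flow F \<Omega> T x = x" and y: "y \<in> D"
  shows "flow F \<Omega> T y = y"
proof -
  let ?E = "{z \<in> D \<union> \<Gamma>. F z = 0}" and ?\<phi> = "\<lambda>t. flow F \<Omega> t x"
  have sol: "is_sol F \<Omega> x UNIV ?\<phi>" using flow_sol[OF x_dom] x_global by simp
  have "\<forall>t\<ge>0. ?\<phi> t \<in> \<Gamma>" unfolding orbit_def x_global by blast
  from real_sol_to_strip[OF sol _ inside_topology(7) orbit_dom this]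
  obtain r \<psi> where r: "0 < r" and \<psi>: "csol (half_strip r) \<psi>"
    and \<psi>\<phi>: "\<forall>t>0. \<psi> (of_real t) = ?\<phi> t" by blast
  have one: "1 \<in> half_strip r" "1 + of_real T \<in> half_strip r"
    using r T unfolding half_strip_def by simp_all
  have "?\<phi> (1 + T) = ?\<phi> 1" using flow_periodic[OF x_dom x_global T(2), of 1 1] by simp
  then have p1: "\<psi> (1 + of_real T) = \<psi> 1"
    using \<psi>\<phi>[rule_format, of 1] \<psi>\<phi>[rule_format, of "1 + T"] T(1) by simp
  have fixed: "flow F \<Omega> T (\<psi> s) = \<psi> s" if s: "s \<in> half_strip r" for s
  proof -
    have "s + of_real T \<in> half_strip r" using s T(1) unfolding half_strip_def by simp
    from csol_period[OF open_half_strip convex_half_strip \<psi> one p1 s this]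
    show ?thesis using strip_flow(2)[OF \<psi> s, of T] T(1) by simp
  qed
  have \<psi>1: "\<psi> 1 = ?\<phi> 1" using \<psi>\<phi>[rule_format, of 1] by simp
  have F1: "F (\<psi> 1) \<noteq> 0" unfolding \<psi>1 by (rule flow_not_equilibrium[OF x_dom x_regular x_global])
  then have "deriv \<psi> 1 \<noteq> 0" using \<psi> one(1) DERIV_imp_deriv unfolding csol_def by metis
  from has_complex_derivative_locally_invertible[OF csol_holomorphic[OF \<psi>] one(1) open_half_strip this]
  obtain e where e: "e > 0" "ball 1 e \<subseteq> half_strip r" "open (\<psi> ` ball 1 e)" by blast
  define V where "V = \<psi> ` ball 1 e - ?E"
  have V: "open V" "\<psi> 1 \<in> V"
    unfolding V_def using e finite_zeros F1 by (auto intro!: open_Diff finite_imp_closed)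
  have "\<psi> 1 \<in> closure D"
    using \<psi>1 inside_topology(6) unfolding frontier_def orbit_def x_global by blast
  then have "V \<inter> D \<noteq> {}" using V open_Int_closure_eq_empty[of V D] by blast
  show ?thesis
  proof (cases "F y = 0")
    case True
    then show ?thesis using flow_const y inside_dom by blast
  next
    case False
    show ?thesis
    proof (rule analytic_continuation_open[of "V \<inter> D" "D - ?E" "\<lambda>z. flow F \<Omega> T z" "\<lambda>z. z"])
      show "flow F \<Omega> T z = z" if "z \<in> V \<inter> D" for z
        using that fixed e(2) unfolding V_def by blast
      show "(\<lambda>z. flow F \<Omega> T z) holomorphic_on D - ?E" "open (D - ?E)" "connected (D - ?E)"
        using regular_inside T(1) by auto
    qed (use V \<open>V \<inter> D \<noteq> {}\<close> inside_topology(1) y False in \<open>auto simp: V_def\<close>)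
  qed
qed

text \<open>Since \<open>F\<close> vanishes at \<open>a\<close>, the speed is at most
  \<open>L\<close> times the distance to \<open>a\<close>, so that distance at most doubles over a
  time \<open>h\<close> with \<open>L * h \<le> 1 / 2\<close>. The constant \<open>L\<close> serves
  the whole interior, so the orbit need not stay near \<open>a\<close>.\<close>

lemma flow_lipschitz_at_equilibrium:
  assumes a: "a \<in> D" "F a = 0" and t: "0 \<le> t"
  shows "\<exists>C. \<forall>y\<in>D. norm (flow F \<Omega> t y - a) \<le> C * norm (y - a)"
proof -
  have a\<Omega>: "a \<in> \<Omega>" using a inside_dom by blast
  \<comment> \<open>The difference quotient of \<open>F\<close> at \<open>a\<close>, holomorphic
    across \<open>a\<close> and hence bounded on the compact hull.\<close>
  define q where "q = (\<lambda>z. if z = a then deriv F a else (F z - F a) / (z - a))"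
  have "q holomorphic_on \<Omega>"
    unfolding q_def using pole_lemma[OF holo] a\<Omega> open_dom interior_open by blast
  then have "compact (q ` (D \<union> \<Gamma>))"
    by (intro compact_continuous_image compact_hull)
       (meson compact_hull(2) continuous_on_subset holomorphic_on_imp_continuous_on)
  then obtain L where L: "0 < L" "\<And>z. z \<in> D \<union> \<Gamma> \<Longrightarrow> norm (q z) \<le> L"
    by (metis bounded_pos compact_imp_bounded imageI)
  have FL: "norm (F z) \<le> L * norm (z - a)" if "z \<in> D" for z
  proof -
    have "F z = q z * (z - a)" unfolding q_def using a(2) by simp
    then show ?thesis using L(2)[of z] that by (simp add: norm_mult mult_right_mono)
  qed
  have small: "norm (flow F \<Omega> h y - a) \<le> 2 * norm (y - a)" if y: "y \<in> D" and h: "0 \<le> h" "L * h \<le> 1 / 2" for y h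
  proof -
    let ?\<phi> = "\<lambda>t. flow F \<Omega> t y"
    have y\<Omega>: "y \<in> \<Omega>" using y inside_dom by blast
    have "continuous_on {0..h} (\<lambda>t. norm (?\<phi> t - a))"
      by (intro continuous_intros continuous_flow y\<Omega> inside_global y)
    then obtain m where m: "m \<in> {0..h}" "\<And>t. t \<in> {0..h} \<Longrightarrow> norm (?\<phi> t - a) \<le> norm (?\<phi> m - a)"
      using continuous_attains_sup[of "{0..h}" "\<lambda>t. norm (?\<phi> t - a)"] h by auto
    have "norm (?\<phi> m - ?\<phi> 0) \<le> (L * norm (?\<phi> m - a)) * norm (m - 0)"
    proof (rule differentiable_bound[of "{0..h}" ?\<phi> "\<lambda>t l. l *\<^sub>R F (?\<phi> t)"])
      fix t assume t: "t \<in> {0..h}"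
      have "(?\<phi> has_vector_derivative F (?\<phi> t)) (at t)"
        using flow_sol[OF y\<Omega>] inside_global[OF y] unfolding is_sol_def by blast
      then show "(?\<phi> has_derivative (\<lambda>l. l *\<^sub>R F (?\<phi> t))) (at t within {0..h})"
        using has_vector_derivative_at_within has_vector_derivative_def by blast
      have "norm (F (?\<phi> t)) \<le> L * norm (?\<phi> t - a)" by (rule FL[OF flow_in_inside[OF y]])
      also have "\<dots> \<le> L * norm (?\<phi> m - a)" using m(2)[OF t] L(1) by simp
      finally show "onorm (\<lambda>l. l *\<^sub>R F (?\<phi> t)) \<le> L * norm (?\<phi> m - a)"
        by (simp add: onorm_scaleR_left[OF bounded_linear_ident] onorm_id)
    qed (use m h in auto)
    also have "\<dots> \<le> (L * norm (?\<phi> m - a)) * h"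
      using m(1) L(1) by (intro mult_left_mono) auto
    also have "\<dots> = (L * h) * norm (?\<phi> m - a)" by simp
    also have "\<dots> \<le> 1 / 2 * norm (?\<phi> m - a)" using h(2) by (intro mult_right_mono) auto
    finally have "norm (?\<phi> m - y) \<le> 1 / 2 * norm (?\<phi> m - a)" using flow_0[OF y\<Omega>] by simp
    moreover have "norm (?\<phi> m - a) \<le> norm (?\<phi> m - y) + norm (y - a)"
      using norm_triangle_ineq[of "?\<phi> m - y" "y - a"] by simp
    ultimately have "norm (?\<phi> m - a) \<le> 2 * norm (y - a)" by linarith
    then show ?thesis using m(2)[of h] h by auto
  qed
  \<comment> \<open>Enough equal steps to bring each step length \<open>t / real n\<close> into the
    range of \<open>small\<close>.\<close>
  obtain n :: nat where n: "2 * L * t < real n" using reals_Archimedean2 by blast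
  then have n0: "0 < real n" using L(1) t by (smt (verit) mult_nonneg_nonneg)
  define h where "h = t / real n"
  have h: "0 \<le> h" "L * h \<le> 1 / 2" unfolding h_def using n n0 t by (auto simp: field_simps)
  have "norm (flow F \<Omega> (real k * h) y - a) \<le> 2 ^ k * norm (y - a)" if y: "y \<in> D" for k y
  proof (induction k)
    case 0 then show ?case using flow_0 y inside_dom by auto
  next
    case (Suc k)
    have y\<Omega>: "y \<in> \<Omega>" using y inside_dom by blast
    have "flow F \<Omega> (real (Suc k) * h) y = flow F \<Omega> h (flow F \<Omega> (real k * h) y)"
      using flow_add_global[OF y\<Omega> inside_global[OF y], of h "real k * h"] by (simp add: algebra_simps)
    then show ?case using small[OF flow_in_inside[OF y] h, of "real k * h"] Suc by simp
  qed
  from this[of _ n] show ?thesis unfolding h_def using n0 by auto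
qed

text \<open>The estimate at equilibria is continuity of the time-\<open>t\<close> map there, which
  makes these isolated singularities removable.\<close>

lemma flow_holomorphic_inside:
  assumes t: "0 \<le> t"
  shows "(\<lambda>z. flow F \<Omega> t z) holomorphic_on D"
proof (rule no_isolated_singularity'[OF _ regular_inside(3)[OF t] inside_topology(1) finite_zeros])
  fix a assume a: "a \<in> {z \<in> D \<union> \<Gamma>. F z = 0}"
  show "((\<lambda>z. flow F \<Omega> t z) \<longlongrightarrow> flow F \<Omega> t a) (at a within D)"
  proof -
    have "F z \<noteq> 0" if "z \<in> \<Gamma>" for z
      using that flow_not_equilibrium[OF x_dom x_regular x_global] unfolding orbit_def by blast
    then have aD: "a \<in> D" "F a = 0" using a by auto
    obtain C where C: "\<And>y. y \<in> D \<Longrightarrow> norm (flow F \<Omega> t y - a) \<le> C * norm (y - a)"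
      using flow_lipschitz_at_equilibrium[OF aD t] by blast
    have "((\<lambda>y. C * norm (y - a)) \<longlongrightarrow> C * norm (a - a)) (at a within D)"
      by (intro tendsto_intros)
    then have lim: "((\<lambda>y. C * norm (y - a)) \<longlongrightarrow> 0) (at a within D)" by simp
    have "((\<lambda>y. flow F \<Omega> t y - a) \<longlongrightarrow> 0) (at a within D)"
    proof (rule Lim_null_comparison[OF _ lim])
      show "\<forall>\<^sub>F y in at a within D. norm (flow F \<Omega> t y - a) \<le> C * norm (y - a)"
        unfolding eventually_at_filter using C by (auto intro: always_eventually)
    qed
    moreover have "flow F \<Omega> t a = a" using flow_const aD inside_dom by blast
    ultimately show ?thesis by (simp add: LIM_zero_iff)
  qed
qed

text \<open>The map for the small time \<open>e / 2\<close> sends the interior into itself and fixes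
  \<open>a\<close> and \<open>b\<close>. Were they distinct, it would be the identity, although the
  regular point \<open>y\<close> does not return before time \<open>e\<close>.\<close>

lemma equilibrium_inside_unique:
  assumes "a \<in> D" "F a = 0" "b \<in> D" "F b = 0"
  shows "a = b"
proof (rule ccontr)
  assume ab: "a \<noteq> b"
  have "infinite D" using inside_topology(1,5) finite_imp_not_open by blast
  then have "\<not> D \<subseteq> {z \<in> D \<union> \<Gamma>. F z = 0}" using finite_zeros finite_subset by blast
  then obtain y where y: "y \<in> D" "F y \<noteq> 0" by blast
  have y\<Omega>: "y \<in> \<Omega>" using y inside_dom by blast
  obtain e where e: "0 < e" "\<forall>t. 0 < t \<and> t < e \<longrightarrow> flow F \<Omega> t y \<noteq> y"
    using flow_no_return_near[OF y\<Omega> y(2)] by blast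
  have "D \<noteq> UNIV" using inside_topology(4) not_bounded_UNIV by metis
  have "flow F \<Omega> (e / 2) y = y"
  proof (rule holomorphic_self_map_two_fixed_points[OF inside_topology(1,3) \<open>D \<noteq> UNIV\<close>
        flow_holomorphic_inside _ assms(1,3) ab _ _ y(1)])
    show "(\<lambda>z. flow F \<Omega> (e / 2) z) ` D \<subseteq> D" using flow_in_inside by blast
    show "flow F \<Omega> (e / 2) a = a" "flow F \<Omega> (e / 2) b = b"
      using flow_const assms inside_dom by blast+
  qed (use e in simp)
  then show False using e(2)[rule_format, of "e / 2"] e(1) by simp
qed

text \<open>If the orbit enclosed no zero of \<open>F\<close>, Cauchy's theorem would make the integral of \<open>1/F\<close>
  along it vanish; but that integral is the elapsed time.\<close>

lemma equilibrium_inside_exists: "\<exists>a\<in>D. F a = 0"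
proof (rule ccontr)
  assume no: "\<not> (\<exists>a\<in>D. F a = 0)"
  \<comment> \<open>\<open>T\<close> is some return time, possibly a multiple of the least one; the
    loop \<open>g\<close> may go round several times.\<close>
  obtain T where T: "0 < T" "flow F \<Omega> T x = x" by (rule period)
  define g where "g = (\<lambda>u. flow F \<Omega> (T * u) x)"
  define S where "S = {z \<in> \<Omega>. F z \<noteq> 0}"
  have "S = \<Omega> \<inter> F -` (- {0})" unfolding S_def by auto
  then have S: "open S"
    using continuous_open_preimage[OF field_continuous open_dom open_delete[OF open_UNIV, of 0]]
    by (simp add: Compl_eq_Diff_UNIV)
  have img: "path_image g = \<Gamma>"
  proof -
    have "(\<lambda>u. T * u) ` {0..1} = {0..T}" using image_mult_atLeastAtMost[of T 0 1] T(1) by simp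
    then have "path_image g = (\<lambda>t. flow F \<Omega> t x) ` {0..T}"
      using image_image[of "\<lambda>t. flow F \<Omega> t x" "\<lambda>u. T * u" "{0..1}"] unfolding path_image_def g_def by simp
    then show ?thesis using orbit_eq_period_image[OF x_dom x_global T] by simp
  qed
  have nz: "F (g u) \<noteq> 0" for u
    unfolding g_def by (rule flow_not_equilibrium[OF x_dom x_regular x_global])
  have der: "(g has_vector_derivative (of_real T * F (g u))) (at u)" for u
  proof -
    have "((\<lambda>u. T * u) has_vector_derivative T) (at u)" by (auto intro!: derivative_eq_intros)
    moreover have "((\<lambda>t. flow F \<Omega> t x) has_vector_derivative F (g u)) (at (T * u))"
      using flow_sol[OF x_dom] x_global unfolding is_sol_def g_def by blast
    ultimately show ?thesis
      using vector_diff_chain_at[of "\<lambda>u. T * u" T u "\<lambda>t. flow F \<Omega> t x"] unfolding o_def g_def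
      by (simp add: scaleR_conv_of_real)
  qed
  have gc: "continuous_on A g" for A
    using der has_vector_derivative_continuous by (blast intro: continuous_at_imp_continuous_on)
  have "continuous_on {0..1} (\<lambda>u. of_real T * F (g u))"
    by (intro continuous_intros continuous_on_compose2[OF field_continuous gc])
       (use flow_in_dom[OF x_dom] x_global in \<open>auto simp: g_def\<close>)
  then have "g C1_differentiable_on {0..1}" unfolding C1_differentiable_on_def
    by (intro exI[of _ "\<lambda>u. of_real T * F (g u)"] conjI ballI der)
  then have vp: "valid_path g" unfolding valid_path_def by (rule C1_differentiable_imp_piecewise)
  have loop: "pathfinish g = pathstart g"
    unfolding pathfinish_def pathstart_def g_def using T flow_0 x_dom by simp
  have sub: "path_image g \<subseteq> S"
  proof
    fix z assume z: "z \<in> path_image g"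
    then obtain u where "z = g u" unfolding path_image_def by blast
    then show "z \<in> S" using nz[of u] z orbit_dom img unfolding S_def by blast
  qed
  \<comment> \<open>Two kinds of points have to be avoided: zeros of \<open>F\<close> in \<Omega>,
    which by assumption lie outside the orbit, and points outside \<Omega>, about which a loop in a
    simply connected domain does not wind.\<close>
  have "winding_number g w = 0" if "w \<notin> S" for w
  proof (cases "w \<in> \<Omega>")
    case True
    then have "F w = 0" using that unfolding S_def by blast
    then have "w \<notin> D" "w \<notin> \<Gamma>" using no sub img unfolding S_def by blast+
    then have "w \<in> outside (path_image g)" unfolding img using inside_Un_outside[of \<Gamma>] by blast
    then show ?thesis using winding_number_zero_in_outside[OF valid_path_imp_path[OF vp] loop] by blast
  next
    case False
    then show ?thesis
      using sconn open_dom simply_connected_eq_winding_number_zero[of \<Omega>] valid_path_imp_path[OF vp] loop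
        orbit_dom img by metis
  qed
  moreover have "(\<lambda>z. 1 / F z) holomorphic_on S"
    by (intro holomorphic_intros holomorphic_on_subset[OF holo]) (auto simp: S_def)
  ultimately have "((\<lambda>z. 1 / F z) has_contour_integral 0) g"
    using Cauchy_theorem_global[OF S _ vp loop sub] by blast
  moreover have "((\<lambda>z. 1 / F z) has_contour_integral (of_real T)) g"
  proof -
    have "((\<lambda>u::real. complex_of_real T) has_integral of_real T) {0..1}"
      using has_integral_const_real[of "complex_of_real T" 0 1] by simp
    \<comment> \<open>The differential equation cancels \<open>F\<close>, so the integrand is the
      constant \<open>T\<close>.\<close>
    moreover have "1 / F (g u) * vector_derivative g (at u) = of_real T" for u
      using vector_derivative_at[OF der] nz by simp
    ultimately show ?thesis unfolding has_contour_integral by simp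
  qed
  ultimately have "complex_of_real T = 0" by (rule has_contour_integral_unique[rotated])
  then show False using T(1) by simp
qed

text \<open>The orbit of \<open>y\<close> is itself periodic, so it encloses an equilibrium. Its
  interior is contained in \<open>D\<close>, where \<open>a\<close> is the only candidate.\<close>

lemma inside_is_periodic_annulus:
  assumes a: "a \<in> D" "F a = 0" and y: "y \<in> D" "y \<noteq> a"
  shows "periodic_orbit F \<Omega> y \<and> a \<in> inside (orbit F \<Omega> y)"
proof -
  have y\<Omega>: "y \<in> \<Omega>" using y inside_dom by blast
  have Fy: "F y \<noteq> 0" using equilibrium_inside_unique a y by blast
  obtain T where T: "0 < T" "flow F \<Omega> T x = x" by (rule period)
  have py: "periodic_orbit F \<Omega> y"
    using return_imp_periodic_orbit[OF y\<Omega> Fy T(1)] inside_periodic[OF T y(1)] inside_global[OF y(1)]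
    by simp
  interpret Y: periodic_field F \<Omega> y by unfold_locales (rule conn sconn py)+
  obtain b where b: "b \<in> inside (orbit F \<Omega> y)" "F b = 0" using Y.equilibrium_inside_exists by blast
  have "inside (orbit F \<Omega> y) \<subseteq> D"
    by (rule subset_simply_connected_imp_inside_subset[OF inside_topology(3,1) orbit_in_inside[OF y(1)]])
  then have "b = a" using equilibrium_inside_unique a b by blast
  then show ?thesis using b py by blast
qed

lemma center_inside:
  assumes a: "a \<in> D" "F a = 0"
  shows "center F \<Omega> a"
proof -
  obtain \<delta> where "\<delta> > 0" "ball a \<delta> \<subseteq> D" using inside_topology(1) a(1) open_contains_ball by blast
  then have "\<forall>y\<in>ball a \<delta> - {a}. closed_orbit F \<Omega> y \<and> a \<in> inside (orbit F \<Omega> y)"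
    using inside_is_periodic_annulus[OF a] unfolding periodic_orbit_def by blast
  then show ?thesis
    unfolding center_def equilibrium_def using \<open>\<delta> > 0\<close> a inside_dom by blast
qed

lemma periodic_orbit_encloses_center:
  "(\<exists>!a. equilibrium F \<Omega> a \<and> a \<in> D) \<and> (\<forall>a. equilibrium F \<Omega> a \<and> a \<in> D \<longrightarrow> center F \<Omega> a)"
proof -
  obtain a where "a \<in> D" "F a = 0" using equilibrium_inside_exists by blast
  then have "\<exists>!a. equilibrium F \<Omega> a \<and> a \<in> D"
    using equilibrium_inside_unique inside_dom unfolding equilibrium_def by blast
  then show ?thesis using center_inside unfolding equilibrium_def by blast
qed

end

theorem theorem5p1:
  fixes F :: "complex \<Rightarrow> complex" and \<Omega> K :: "complex set" and \<xi> :: complex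
  assumes "open \<Omega>" and "connected \<Omega>" and "simply_connected \<Omega>"
    and "F holomorphic_on \<Omega>" and "\<exists>z\<in>\<Omega>. F z \<noteq> 0"
    and "compact K" and "K \<subseteq> \<Omega>" and "\<xi> \<in> K"
  shows
   "(pos_orbit F \<Omega> \<xi> \<subseteq> K \<longrightarrow>
      ((periodic_orbit F \<Omega> \<xi> \<and>
        (\<exists>!a. equilibrium F \<Omega> a \<and> a \<in> inside (orbit F \<Omega> \<xi>)) \<and>
        (\<forall>a. equilibrium F \<Omega> a \<and> a \<in> inside (orbit F \<Omega> \<xi>) \<longrightarrow> center F \<Omega> a))
       \<or> (\<exists>a. equilibrium F \<Omega> a \<and> pos_limit_set F \<Omega> \<xi> = {a})))
    \<and> (neg_orbit F \<Omega> \<xi> \<subseteq> K \<longrightarrow>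
      ((periodic_orbit F \<Omega> \<xi> \<and>
        (\<exists>!a. equilibrium F \<Omega> a \<and> a \<in> inside (orbit F \<Omega> \<xi>)) \<and>
        (\<forall>a. equilibrium F \<Omega> a \<and> a \<in> inside (orbit F \<Omega> \<xi>) \<longrightarrow> center F \<Omega> a))
       \<or> (\<exists>a. equilibrium F \<Omega> a \<and> neg_limit_set F \<Omega> \<xi> = {a})))
    \<and> (periodic_orbit F \<Omega> \<xi> \<longrightarrow>
       (\<forall>a. center F \<Omega> a \<and> a \<in> inside (orbit F \<Omega> \<xi>) \<longrightarrow>
          (\<forall>y \<in> inside (orbit F \<Omega> \<xi>) - {a}. periodic_orbit F \<Omega> y \<and> a \<in> inside (orbit F \<Omega> y))))"
proof -
  interpret holo_field F \<Omega> by unfold_locales (rule assms)+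
  interpret R: holo_field "\<lambda>z. - F z" \<Omega> by (rule reverse_holo_field)
  have \<xi>: "\<xi> \<in> \<Omega>" using assms(7,8) by blast
  have P: "periodic_field F \<Omega> \<xi>" if "periodic_orbit F \<Omega> \<xi>"
    by unfold_locales (rule assms that)+
  have pos: "periodic_orbit F \<Omega> \<xi> \<or> (\<exists>a. equilibrium F \<Omega> a \<and> pos_limit_set F \<Omega> \<xi> = {a})"
    if "pos_orbit F \<Omega> \<xi> \<subseteq> K"
    by (rule periodic_or_convergent[OF assms(2,3,5-8) that])
  \<comment> \<open>Reversing time exchanges the two half orbits and limit sets while keeping
    equilibria; a periodic orbit of the reversed field is periodic for \<open>F\<close>.\<close>
  have neg: "periodic_orbit F \<Omega> \<xi> \<or> (\<exists>a. equilibrium F \<Omega> a \<and> neg_limit_set F \<Omega> \<xi> = {a})"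
    if "neg_orbit F \<Omega> \<xi> \<subseteq> K"
  proof -
    have "\<exists>z\<in>\<Omega>. - F z \<noteq> 0" using assms(5) by simp
    moreover have "pos_orbit (\<lambda>z. - F z) \<Omega> \<xi> \<subseteq> K"
      using that reverse_pos_orbit[OF \<xi>] by simp
    ultimately have "periodic_orbit (\<lambda>z. - F z) \<Omega> \<xi> \<or>
        (\<exists>a. equilibrium (\<lambda>z. - F z) \<Omega> a \<and> pos_limit_set (\<lambda>z. - F z) \<Omega> \<xi> = {a})"
      by (rule R.periodic_or_convergent[OF assms(2,3) _ assms(6-8)])
    then show ?thesis
      using reverse_periodic_orbit unfolding reverse_pos_limit_set[OF \<xi>] equilibrium_def by auto
  qed
  have ann: "periodic_orbit F \<Omega> y \<and> a \<in> inside (orbit F \<Omega> y)"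
    if "periodic_orbit F \<Omega> \<xi>" "center F \<Omega> a" "a \<in> inside (orbit F \<Omega> \<xi>)"
      "y \<in> inside (orbit F \<Omega> \<xi>) - {a}" for a y
    using periodic_field.inside_is_periodic_annulus[OF P[OF that(1)], of a y] that(2-4)
    unfolding center_def equilibrium_def by blast
  show ?thesis
    using pos neg ann periodic_field.periodic_orbit_encloses_center[OF P] by blast
qed

end
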